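(* Let $d,n\ge1$ be integers, $H\in(0,1)$, let $\Lambda\subset\mathbb Z^d$ be finite and let $\tau:\mathbb Z^d\to\mathbb R^n$. Almost surely, there exists a unique $\varphi\in\Omega^{\Lambda,\tau}$ such that $$\mathcal H^{\eta,\Lambda}(\varphi)=\min_{\psi\in\Omega^{\Lambda,\tau}}\mathcal H^{\eta,\Lambda}(\psi).$$
   Context: $\|\cdot\|$ is the Euclidean norm on $\mathbb R^n$. An $n$-dimensional fractional Brownian field of Hurst parameter $H$ is a real-valued, sample-path continuous, centered Gaussian process $(B_t)_{t\in\mathbb R^n}$ with $B_0=0$ and $\mathrm{Var}(B_t-B_s)=\|t-s\|^{2H}$ for all $s,t\in\mathbb R^n$. The disorder $\eta=(\eta_{v,t})_{v\in\mathbb Z^d,t\in\mathbb R^n}$ is random: the processes $t\mapsto\eta_{v,t}$, $v\in\mathbb Z^d$, are independent, each distributed as such a field. For finite $\Lambda\subset\mathbb Z^d$ and $\varphi:\mathbb Z^d\to\mathbb R^n$ the Hamiltonian is $$\mathcal H^{\eta,\Lambda}(\varphi)=\frac12\sum_{u\sim v,\ \{u,v\}\cap\Lambda\ne\emptyset}\|\varphi_u-\varphi_v\|^2+\sum_{v\in\Lambda}\eta_{v,\varphi_v},$$ where the first sum is over unordered pairs of adjacent vertices of $\mathbb Z^d$. The configuration space with boundary values $\tau$ is $\Omega^{\Lambda,\tau}=\{\varphi:\mathbb Z^d\to\mathbb R^n:\varphi_v=\tau_v\text{ for }v\in\mathbb Z^d\setminus\Lambda\}$. *)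

theory Defs
  imports "HOL-Probability.Probability"
begin

text \<open>
  The lattice is \<open>int ^ 'd\<close> and spins take values in \<open>real ^ 'n\<close>, so the dimensions
  are \<open>CARD('d)\<close> and \<open>CARD('n)\<close>, both automatically at least 1.
\<close>

section \<open>Fractional Brownian fields\<close>

text \<open>Constants count as (degenerate) Gaussian variables.\<close>

definition gaussian_variable :: "'w measure \<Rightarrow> ('w \<Rightarrow> real) \<Rightarrow> bool" where
  "gaussian_variable M X \<longleftrightarrow> X \<in> borel_measurable M \<and>
     ((\<exists>\<mu>. AE \<omega> in M. X \<omega> = \<mu>) \<or>
      (\<exists>\<mu> \<sigma>. \<sigma> > 0 \<and> distributed M lborel X (\<lambda>x. ennreal (normal_density \<mu> \<sigma> x))))"

definition gaussian_process :: "'w measure \<Rightarrow> ('t \<Rightarrow> 'w \<Rightarrow> real) \<Rightarrow> bool" where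
  "gaussian_process M B \<longleftrightarrow>
     (\<forall>T c. finite T \<longrightarrow> gaussian_variable M (\<lambda>\<omega>. \<Sum>t\<in>T. c t * B t \<omega>))"

text \<open>Path continuity and \<open>B\<^sub>0 = 0\<close> are required almost surely.\<close>

definition fractional_brownian_field ::
    "'w measure \<Rightarrow> real \<Rightarrow> (real ^ 'n \<Rightarrow> 'w \<Rightarrow> real) \<Rightarrow> bool" where
  "fractional_brownian_field M H B \<longleftrightarrow>
     gaussian_process M B \<and>
     (\<forall>t. prob_space.expectation M (B t) = 0) \<and>
     (AE \<omega> in M. continuous_on UNIV (\<lambda>t. B t \<omega>)) \<and>
     (AE \<omega> in M. B 0 \<omega> = 0) \<and>
     (\<forall>s t. prob_space.variance M (\<lambda>\<omega>. B t \<omega> - B s \<omega>) = norm (t - s) powr (2 * H))"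

text \<open>
  Independence is that of the whole processes, viewed as random elements of the space of all
  functions \<open>real ^ 'n \<Rightarrow> real\<close> with the product sigma-algebra.
\<close>

definition fbf_disorder ::
    "'w measure \<Rightarrow> real \<Rightarrow> (int ^ 'd \<Rightarrow> real ^ 'n \<Rightarrow> 'w \<Rightarrow> real) \<Rightarrow> bool" where
  "fbf_disorder M H \<eta> \<longleftrightarrow>
     (\<forall>v. fractional_brownian_field M H (\<eta> v)) \<and>
     prob_space.indep_vars M (\<lambda>_. Pi\<^sub>M UNIV (\<lambda>_. borel)) (\<lambda>v \<omega> t. \<eta> v t \<omega>) UNIV"


section \<open>The Hamiltonian\<close>

definition lattice_adj :: "int ^ 'd \<Rightarrow> int ^ 'd \<Rightarrow> bool" where
  "lattice_adj u v \<longleftrightarrow> (\<Sum>i\<in>UNIV. \<bar>u $ i - v $ i\<bar>) = 1"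

definition edges_meeting :: "(int ^ 'd) set \<Rightarrow> (int ^ 'd) set set" where
  "edges_meeting \<Lambda> = {{u, v} | u v. lattice_adj u v \<and> {u, v} \<inter> \<Lambda> \<noteq> {}}"

text \<open>
  Edges are unordered pairs; the value does not depend on the choice of endpoints, see
  \<open>edge_energy_pair\<close> below.
\<close>

definition edge_energy :: "(int ^ 'd \<Rightarrow> real ^ 'n) \<Rightarrow> (int ^ 'd) set \<Rightarrow> real" where
  "edge_energy \<phi> e = (THE r. \<exists>u v. e = {u, v} \<and> r = (norm (\<phi> u - \<phi> v))\<^sup>2)"

definition hamiltonian ::
    "(int ^ 'd \<Rightarrow> real ^ 'n \<Rightarrow> real) \<Rightarrow> (int ^ 'd) set \<Rightarrow> (int ^ 'd \<Rightarrow> real ^ 'n) \<Rightarrow> real" where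
  "hamiltonian \<eta> \<Lambda> \<phi> = 1/2 * (\<Sum>e\<in>edges_meeting \<Lambda>. edge_energy \<phi> e) + (\<Sum>v\<in>\<Lambda>. \<eta> v (\<phi> v))"

definition configurations ::
    "(int ^ 'd) set \<Rightarrow> (int ^ 'd \<Rightarrow> real ^ 'n) \<Rightarrow> (int ^ 'd \<Rightarrow> real ^ 'n) set" where
  "configurations \<Lambda> \<tau> = {\<phi>. \<forall>v. v \<notin> \<Lambda> \<longrightarrow> \<phi> v = \<tau> v}"

lemma edge_energy_pair: "edge_energy \<phi> {u, v} = (norm (\<phi> u - \<phi> v))\<^sup>2"
  unfolding edge_energy_def
  by (rule the_equality) (auto simp: doubleton_eq_iff norm_minus_commute)

lemma lattice_adj_sym: "lattice_adj u v \<longleftrightarrow> lattice_adj v u"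
  by (simp add: lattice_adj_def abs_minus_commute)

lemma finite_lattice_neighbours: "finite {v :: int ^ 'd. lattice_adj u v}"
proof -
  have "v $ i \<in> {u $ i - 1..u $ i + 1}" if "lattice_adj u v" for v i
  proof -
    have "\<bar>u $ i - v $ i\<bar> \<le> (\<Sum>j\<in>UNIV. \<bar>u $ j - v $ j\<bar>)"
      by (rule member_le_sum) auto
    then show ?thesis using that by (auto simp: lattice_adj_def)
  qed
  then have "{v. lattice_adj u v} \<subseteq> vec_lambda ` (\<Pi>\<^sub>E i\<in>UNIV. {u $ i - 1..u $ i + 1})"
    by (intro subsetI image_eqI[where x = "vec_nth v" for v]) (auto simp: vec_nth_inverse)
  moreover have "finite (\<Pi>\<^sub>E i\<in>(UNIV :: 'd set). {u $ i - 1..u $ i + 1})"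
    by (rule finite_PiE) auto
  ultimately show ?thesis
    by (meson finite_imageI finite_subset)
qed

lemma finite_edges_meeting:
  assumes "finite \<Lambda>"
  shows "finite (edges_meeting \<Lambda>)"
proof -
  have "edges_meeting \<Lambda> \<subseteq> (\<Union>u\<in>\<Lambda>. (\<lambda>v. {u, v}) ` {v. lattice_adj u v})"
    by (fastforce simp: edges_meeting_def insert_commute lattice_adj_sym)
  then show ?thesis
    using assms finite_lattice_neighbours by (meson finite_UN_I finite_imageI finite_subset)
qed

end

theory Submission
  imports Defs
begin

text \<open>
  Existence is a deterministic consequence of two almost sure properties of the disorder:
  its paths are continuous and grow at most linearly. The quadratic edge energy controls the
  norm of every spin in \<open>\<Lambda>\<close>, because a straight walk along the lattice leads from each vertex
  of \<open>\<Lambda>\<close> to a vertex with prescribed value (\<open>discrete_poincare\<close>). Hence the energy beats any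
  linearly growing disorder, sublevel sets are bounded, and a minimiser exists by compactness.
  Linear growth (\<open>fbf_linear_growth\<close>) comes from chaining through dyadic grids
  inside the cubes of side \<open>2 ^ (N + 1)\<close>, for all \<open>N\<close> simultaneously; the condition \<open>H < 1\<close> makes
  high Gaussian moments of the grid increments, measured in units of \<open>2 ^ N\<close>, summable over \<open>N\<close>.

  For uniqueness, suppose that two minimisers differ at \<open>v\<close>. Choose \<open>p\<close>, \<open>q\<close> from a countable dense
  set near the two values at \<open>v\<close>, and put \<open>\<xi> = \<eta>\<^sub>v\<^sub>,\<^sub>p - \<eta>\<^sub>v\<^sub>,\<^sub>q\<close>. Regressing the disorder on \<open>\<xi>\<close> gives
  \<open>\<eta>\<^sub>v\<^sub>,\<^sub>t = \<eta>'\<^sub>t + g t * \<xi>\<close>, where \<open>\<xi>\<close> is independent of \<open>\<eta>'\<close> and of the disorder at the other vertices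
  (\<open>fbf_disorder_decoupling\<close>). The function \<open>g\<close> is larger at points closer to \<open>p\<close> than at points
  closer to \<open>q\<close>. So, when everything except \<open>\<xi>\<close> is fixed, raising \<open>\<xi>\<close> favours strictly the
  configurations on one side, and there is at most one value of \<open>\<xi>\<close> for which the minimum is
  attained on both sides
  (\<open>two_sided_near_minimal_tilt_unique\<close>). Since the law of \<open>\<xi>\<close> has no atoms, this has
  probability zero, and only countably many choices of \<open>v\<close>, \<open>p\<close>, \<open>q\<close> and of a separation margin
  are needed. Working with approximate minimisers in a countable dense set of configurations
  keeps the exceptional event measurable.
\<close>

section \<open>Independence from factorising characteristic functions\<close>

lemma (in prob_space) integrable_mult_iexp:
  fixes W :: "'a \<Rightarrow> complex"
  assumes [measurable]: "W \<in> borel_measurable M" "Y \<in> borel_measurable M"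
    and bd: "\<And>\<omega>. cmod (W \<omega>) \<le> c"
  shows "integrable M (\<lambda>\<omega>. W \<omega> * iexp (Y \<omega>))"
  by (rule integrable_const_bound[where B = c]) (auto simp: norm_mult bd)

text \<open>
  The bounded weight \<open>W\<close> is turned into the density \<open>1 + W / k\<close>. Under this density the law of
  \<open>Y\<close> has the same characteristic function as before, so it is the same law by Levy's theorem.
\<close>

lemma (in prob_space) weight_orthogonal_iexp_real:
  fixes W Y :: "'a \<Rightarrow> real"
  assumes [measurable]: "W \<in> borel_measurable M" "Y \<in> borel_measurable M"
    and bd: "\<And>\<omega>. \<bar>W \<omega>\<bar> \<le> c"
    and zero: "\<And>b. (CLINT \<omega>|M. of_real (W \<omega>) * iexp (b * Y \<omega>)) = 0"
    and [measurable]: "A \<in> sets borel"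
  shows "(LINT \<omega>|M. W \<omega> * indicator A (Y \<omega>)) = 0"
proof -
  \<comment> \<open>A strictly positive bound, so that \<open>1 + W / k\<close> is defined and nonnegative.\<close>
  define k where "k = \<bar>c\<bar> + 1"
  have k: "k > 0" and bk: "\<bar>W \<omega>\<bar> \<le> k" for \<omega>
    using bd[of \<omega>] by (auto simp: k_def)
  define h where "h \<omega> = 1 + W \<omega> / k" for \<omega>
  have h_nonneg: "0 \<le> h \<omega>" for \<omega>
    using k bk[of \<omega>] by (auto simp: h_def field_simps abs_le_iff)
  have [measurable]: "h \<in> borel_measurable M"
    unfolding h_def[abs_def] by measurable
  have intW: "integrable M W"
    by (rule integrable_const_bound[where B = k]) (auto simp: bk)
  have inth: "integrable M h"
    unfolding h_def[abs_def] using intW by auto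
  have EW: "(LINT \<omega>|M. W \<omega>) = 0"
  proof -
    have "complex_of_real (LINT \<omega>|M. W \<omega>) = 0" using zero[of 0] by simp
    then show ?thesis by (simp only: of_real_eq_0_iff)
  qed
  have Eh: "(LINT \<omega>|M. h \<omega>) = 1"
    unfolding h_def using intW EW by (simp add: prob_space)
  define N where "N = density M (\<lambda>\<omega>. ennreal (h \<omega>))"
  have setsN [measurable_cong]: "sets N = sets M" by (simp add: N_def)
  have "emeasure N (space N) = 1"
    using inth h_nonneg Eh
    by (simp add: N_def emeasure_density nn_integral_eq_integral cong: nn_integral_cong_simp)
  then interpret N: prob_space N by (rule prob_spaceI)
  interpret D1: real_distribution "distr N borel Y"
    by (rule N.real_distribution_distr) measurable
  interpret D2: real_distribution "distr M borel Y"
    by (rule real_distribution_distr) measurable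
  have "char (distr N borel Y) b = char (distr M borel Y) b" for b
  proof -
    have "char (distr N borel Y) b = (CLINT \<omega>|N. iexp (b * Y \<omega>))"
      by (simp add: char_def integral_distr)
    also have "\<dots> = (CLINT \<omega>|M. h \<omega> *\<^sub>R iexp (b * Y \<omega>))"
      unfolding N_def by (rule integral_density) (auto simp: h_nonneg)
    also have "\<dots> = (CLINT \<omega>|M. iexp (b * Y \<omega>) + (1 / k) * (of_real (W \<omega>) * iexp (b * Y \<omega>)))"
      by (rule Bochner_Integration.integral_cong)
        (auto simp: h_def scaleR_conv_of_real algebra_simps)
    also have "\<dots> = (CLINT \<omega>|M. iexp (b * Y \<omega>))"
      using integrable_mult_iexp[of "\<lambda>\<omega>. of_real (W \<omega>)" "\<lambda>\<omega>. b * Y \<omega>" k]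
        integrable_mult_iexp[of "\<lambda>\<omega>. 1" "\<lambda>\<omega>. b * Y \<omega>" 1] zero[of b] bk
      by (subst Bochner_Integration.integral_add) auto
    finally show ?thesis by (simp add: char_def integral_distr)
  qed
  then have eq: "distr N borel Y = distr M borel Y"
    by (intro Levy_uniqueness) (auto simp: fun_eq_iff D1.real_distribution_axioms
        D2.real_distribution_axioms)
  have iA: "integrable M (\<lambda>\<omega>. indicator A (Y \<omega>) :: real)"
    by (rule integrable_const_bound[where B = 1]) (auto simp: indicator_def)
  have iWA: "integrable M (\<lambda>\<omega>. W \<omega> * indicator A (Y \<omega>))"
    by (rule integrable_const_bound[where B = k]) (use bk k in \<open>auto simp: indicator_def\<close>)
  have "(LINT \<omega>|M. indicator A (Y \<omega>) :: real) = (LINT x|distr N borel Y. indicator A x)"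
    unfolding eq by (subst integral_distr) auto
  also have "\<dots> = (LINT \<omega>|N. indicator A (Y \<omega>))"
    by (subst integral_distr) auto
  also have "\<dots> = (LINT \<omega>|M. h \<omega> *\<^sub>R indicator A (Y \<omega>))"
    unfolding N_def by (rule integral_density) (auto simp: h_nonneg)
  also have "\<dots> = (LINT \<omega>|M. indicator A (Y \<omega>) + (1 / k) * (W \<omega> * indicator A (Y \<omega>)))"
    by (rule Bochner_Integration.integral_cong) (auto simp: h_def algebra_simps)
  also have "\<dots> = (LINT \<omega>|M. indicator A (Y \<omega>)) + (1 / k) * (LINT \<omega>|M. W \<omega> * indicator A (Y \<omega>))"
    using iA iWA by (subst Bochner_Integration.integral_add) auto
  finally show ?thesis using k by simp
qed

lemma (in prob_space) weight_orthogonal_iexp: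
  fixes W :: "'a \<Rightarrow> complex" and Y :: "'a \<Rightarrow> real"
  assumes [measurable]: "W \<in> borel_measurable M" "Y \<in> borel_measurable M"
    and bd: "\<And>\<omega>. cmod (W \<omega>) \<le> c"
    and zero: "\<And>b. (CLINT \<omega>|M. W \<omega> * iexp (b * Y \<omega>)) = 0"
    and [measurable]: "A \<in> sets borel"
  shows "(CLINT \<omega>|M. W \<omega> * indicator A (Y \<omega>)) = 0"
proof -
  have [measurable]: "cnj \<in> borel_measurable borel"
    by (intro borel_measurable_continuous_onI continuous_intros)
  have intW: "integrable M (\<lambda>\<omega>. W \<omega> * iexp (b * Y \<omega>))" for b
    by (rule integrable_mult_iexp[OF _ _ bd]) auto
  have conj: "(CLINT \<omega>|M. cnj (W \<omega>) * iexp (b * Y \<omega>)) = 0" for b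
  proof -
    have "(CLINT \<omega>|M. cnj (W \<omega>) * iexp (b * Y \<omega>)) = (CLINT \<omega>|M. cnj (W \<omega> * iexp (- b * Y \<omega>)))"
      by (rule Bochner_Integration.integral_cong) (auto simp: exp_cnj)
    also have "\<dots> = cnj (CLINT \<omega>|M. W \<omega> * iexp (- b * Y \<omega>))"
      by (rule Bochner_Integration.integral_cnj)
    also have "\<dots> = 0" using zero[of "-b"] by simp
    finally show ?thesis .
  qed
  have intcW: "integrable M (\<lambda>\<omega>. cnj (W \<omega>) * iexp (b * Y \<omega>))" for b
    by (rule integrable_mult_iexp[where c = c]) (auto simp: bd)
  have re: "(CLINT \<omega>|M. of_real (Re (W \<omega>)) * iexp (b * Y \<omega>)) = 0" for b
  proof -
    have "(CLINT \<omega>|M. of_real (Re (W \<omega>)) * iexp (b * Y \<omega>)) =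
      (CLINT \<omega>|M. (1/2) * (W \<omega> * iexp (b * Y \<omega>) + cnj (W \<omega>) * iexp (b * Y \<omega>)))"
      by (rule Bochner_Integration.integral_cong)
        (auto simp: complex_add_cnj simp flip: distrib_right)
    also have "\<dots> = 0"
      using zero[of b] conj[of b] intW[of b] intcW[of b] by simp
    finally show ?thesis .
  qed
  have im: "(CLINT \<omega>|M. of_real (Im (W \<omega>)) * iexp (b * Y \<omega>)) = 0" for b
  proof -
    have "(CLINT \<omega>|M. of_real (Im (W \<omega>)) * iexp (b * Y \<omega>)) =
      (CLINT \<omega>|M. (1/(2*\<i>)) * (W \<omega> * iexp (b * Y \<omega>) - cnj (W \<omega>) * iexp (b * Y \<omega>)))"
      by (rule Bochner_Integration.integral_cong)
        (auto simp: complex_eq_iff simp flip: left_diff_distrib)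
    also have "\<dots> = 0"
      using zero[of b] conj[of b] intW[of b] intcW[of b] by simp
    finally show ?thesis .
  qed
  have 1: "(LINT \<omega>|M. Re (W \<omega>) * indicator A (Y \<omega>)) = 0"
    by (rule weight_orthogonal_iexp_real[where c = c])
      (use re bd abs_Re_le_cmod order_trans in \<open>auto, blast\<close>)
  have 2: "(LINT \<omega>|M. Im (W \<omega>) * indicator A (Y \<omega>)) = 0"
    by (rule weight_orthogonal_iexp_real[where c = c])
      (use im bd abs_Im_le_cmod order_trans in \<open>auto, blast\<close>)
  have int: "integrable M (\<lambda>\<omega>. W \<omega> * indicator A (Y \<omega>))"
    by (rule integrable_const_bound[where B = c])
      (use bd order_trans[OF norm_ge_zero bd] in \<open>auto simp: indicator_def\<close>)
  have "Re (CLINT \<omega>|M. W \<omega> * indicator A (Y \<omega>)) = (LINT \<omega>|M. Re (W \<omega>) * indicator A (Y \<omega>))"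
    unfolding integral_Re[OF int, symmetric]
    by (rule Bochner_Integration.integral_cong) (auto simp: indicator_def)
  moreover have "Im (CLINT \<omega>|M. W \<omega> * indicator A (Y \<omega>)) = (LINT \<omega>|M. Im (W \<omega>) * indicator A (Y \<omega>))"
    unfolding integral_Im[OF int, symmetric]
    by (rule Bochner_Integration.integral_cong) (auto simp: indicator_def)
  ultimately show ?thesis using 1 2 by (simp add: complex_eq_iff)
qed

text \<open>
  The uniqueness theorem for characteristic functions of random vectors, in a form that reduces
  to the one-dimensional case: the exponentials are replaced by indicators one coordinate at a
  time, each time absorbing the remaining factors into the weight.
\<close>

lemma (in prob_space) weight_orthogonal_iexp_sum:
  fixes W :: "'a \<Rightarrow> complex" and Y :: "'i \<Rightarrow> 'a \<Rightarrow> real"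
  assumes "finite J"
    and "W \<in> borel_measurable M" and "\<And>j. j \<in> J \<Longrightarrow> Y j \<in> borel_measurable M"
    and "\<And>\<omega>. cmod (W \<omega>) \<le> c"
    and "\<And>b. (CLINT \<omega>|M. W \<omega> * iexp (\<Sum>j\<in>J. b j * Y j \<omega>)) = 0"
    and "\<And>j. j \<in> J \<Longrightarrow> A j \<in> sets borel"
  shows "(CLINT \<omega>|M. W \<omega> * (\<Prod>j\<in>J. indicator (A j) (Y j \<omega>))) = 0"
  using assms
proof (induction J arbitrary: W)
  case empty
  from empty(4) show ?case by simp
next
  case (insert k J)
  note [measurable] = insert.prems(1)
  have [measurable]: "Y k \<in> borel_measurable M" "A k \<in> sets borel"
    using insert.prems by auto
  have mY [measurable]: "j \<in> J \<Longrightarrow> Y j \<in> borel_measurable M" for j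
    using insert.prems by auto
  have zero: "(CLINT \<omega>|M. W \<omega> * indicator (A k) (Y k \<omega>) * iexp (\<Sum>j\<in>J. b j * Y j \<omega>)) = 0" for b
  proof -
    have "(CLINT \<omega>|M. W \<omega> * iexp (\<Sum>j\<in>J. b j * Y j \<omega>) * indicator (A k) (Y k \<omega>)) = 0"
    proof (rule weight_orthogonal_iexp[where c = c])
      fix t
      have "(CLINT \<omega>|M. W \<omega> * iexp (\<Sum>j\<in>J. b j * Y j \<omega>) * iexp (t * Y k \<omega>)) =
          (CLINT \<omega>|M. W \<omega> * iexp (\<Sum>j\<in>insert k J. (b(k := t)) j * Y j \<omega>))"
        (is "?L = ?R")
      proof (rule Bochner_Integration.integral_cong)
        fix \<omega>
        have "(\<Sum>j\<in>insert k J. (b(k := t)) j * Y j \<omega>) = t * Y k \<omega> + (\<Sum>j\<in>J. b j * Y j \<omega>)"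
          using insert.hyps by (auto intro!: sum.cong)
        then show "W \<omega> * iexp (\<Sum>j\<in>J. b j * Y j \<omega>) * iexp (t * Y k \<omega>) =
          W \<omega> * iexp (\<Sum>j\<in>insert k J. (b(k := t)) j * Y j \<omega>)"
          by (simp only: of_real_add distrib_left exp_add mult_ac)
      qed simp
      also have "?R = 0" by (rule insert.prems)
      finally show "?L = 0" .
    qed (use insert.prems in \<open>auto simp: norm_mult\<close>)
    then show ?thesis by (simp add: mult_ac)
  qed
  have c0: "0 \<le> c" using insert.prems(3) norm_ge_zero order_trans by blast
  have "(CLINT \<omega>|M. W \<omega> * indicator (A k) (Y k \<omega>) * (\<Prod>j\<in>J. indicator (A j) (Y j \<omega>))) = 0"
    by (rule insert.IH) (use insert.prems zero c0 in \<open>auto simp: indicator_def\<close>)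
  then show ?case using insert.hyps by (simp add: mult_ac)
qed

text \<open>
  Kac's theorem. Orthogonality to exponentials is converted to orthogonality to indicators, first
  in the variables \<open>Y\<close> with a centered exponential of \<open>X\<close> as weight, then in \<open>X\<close> with a centered
  indicator of a cylinder as weight. Cylinders generate the product sigma-algebra.
\<close>

theorem (in prob_space) kac_independence:
  fixes X :: "'a \<Rightarrow> real" and Y :: "'i \<Rightarrow> 'a \<Rightarrow> real"
  assumes mX [measurable]: "X \<in> borel_measurable M"
    and mY [measurable]: "\<And>i. Y i \<in> borel_measurable M"
    and factor: "\<And>J a b. finite J \<Longrightarrow>
      (CLINT \<omega>|M. iexp (a * X \<omega> + (\<Sum>j\<in>J. b j * Y j \<omega>))) =
      (CLINT \<omega>|M. iexp (a * X \<omega>)) * (CLINT \<omega>|M. iexp (\<Sum>j\<in>J. b j * Y j \<omega>))"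
  shows "distr M borel X \<Otimes>\<^sub>M distr M (Pi\<^sub>M UNIV (\<lambda>_. borel)) (\<lambda>\<omega> i. Y i \<omega>) =
    distr M (borel \<Otimes>\<^sub>M Pi\<^sub>M UNIV (\<lambda>_. borel)) (\<lambda>\<omega>. (X \<omega>, \<lambda>i. Y i \<omega>))"
proof -
  have cyl: "prob ({\<omega>\<in>space M. X \<omega> \<in> B} \<inter> {\<omega>\<in>space M. \<forall>j\<in>J. Y j \<omega> \<in> A j}) =
      prob {\<omega>\<in>space M. X \<omega> \<in> B} * prob {\<omega>\<in>space M. \<forall>j\<in>J. Y j \<omega> \<in> A j}"
    if J: "finite J" and [measurable]: "B \<in> sets borel" and A: "\<And>j. j \<in> J \<Longrightarrow> A j \<in> sets borel"
    for J A B
  proof -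
    have [measurable]: "(\<lambda>\<omega>. \<Prod>j\<in>J. indicator (A j) (Y j \<omega>) :: complex) \<in> borel_measurable M"
      using A by (intro borel_measurable_prod measurable_compose[OF mY borel_measurable_indicator])
    have mE [measurable]: "{\<omega>\<in>space M. \<forall>j\<in>J. Y j \<omega> \<in> A j} \<in> sets M"
      using J A by (intro sets.sets_Collect_finite_All) auto
    define p where "p = prob {\<omega>\<in>space M. \<forall>j\<in>J. Y j \<omega> \<in> A j}"
    have ind: "(\<Prod>j\<in>J. indicator (A j) (Y j \<omega>)) =
        (indicator {\<omega>\<in>space M. \<forall>j\<in>J. Y j \<omega> \<in> A j} \<omega> :: complex)" if "\<omega> \<in> space M" for \<omega>
      using J that by (auto simp: indicator_def prod_zero_iff)
    have p_int: "(CLINT \<omega>|M. \<Prod>j\<in>J. indicator (A j) (Y j \<omega>)) = complex_of_real p"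
    proof -
      have "(CLINT \<omega>|M. \<Prod>j\<in>J. indicator (A j) (Y j \<omega>)) =
          (CLINT \<omega>|M. complex_of_real (indicator {\<omega>\<in>space M. \<forall>j\<in>J. Y j \<omega> \<in> A j} \<omega>))"
        using ind by (intro Bochner_Integration.integral_cong) (auto simp: indicator_def)
      then show ?thesis unfolding integral_complex_of_real p_def by simp
    qed
    have bdprod: "cmod (\<Prod>j\<in>J. indicator (A j) (Y j \<omega>)) \<le> 1" for \<omega>
      by (auto simp: prod_norm[symmetric] indicator_def intro!: prod_le_1)
    have zero1: "(CLINT \<omega>|M. (iexp (a * X \<omega>) - (CLINT \<omega>|M. iexp (a * X \<omega>))) *
        (\<Prod>j\<in>J. indicator (A j) (Y j \<omega>))) = 0" for a
    proof (rule weight_orthogonal_iexp_sum[OF J, where c = 2])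
      have "cmod (CLINT \<omega>|M. iexp (a * X \<omega>)) \<le> (LINT \<omega>|M. cmod (iexp (a * X \<omega>)))"
        by (rule integral_norm_bound)
      also have "\<dots> = 1" by (simp add: prob_space)
      finally have "cmod (CLINT \<omega>|M. iexp (a * X \<omega>)) \<le> 1" .
      then show "cmod (iexp (a * X \<omega>) - (CLINT \<omega>|M. iexp (a * X \<omega>))) \<le> 2" for \<omega>
        using norm_triangle_ineq4[of "iexp (a * X \<omega>)" "CLINT \<omega>|M. iexp (a * X \<omega>)"] by simp
    next
      fix b
      have "(CLINT \<omega>|M. (iexp (a * X \<omega>) - (CLINT \<omega>|M. iexp (a * X \<omega>))) *
          iexp (\<Sum>j\<in>J. b j * Y j \<omega>)) =
        (CLINT \<omega>|M. iexp (a * X \<omega> + (\<Sum>j\<in>J. b j * Y j \<omega>)) -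
          (CLINT \<omega>|M. iexp (a * X \<omega>)) * (1 * iexp (\<Sum>j\<in>J. b j * Y j \<omega>)))"
        by (rule Bochner_Integration.integral_cong)
          (auto simp: distrib_left exp_add left_diff_distrib)
      also have "\<dots> = (CLINT \<omega>|M. iexp (a * X \<omega> + (\<Sum>j\<in>J. b j * Y j \<omega>))) -
        (CLINT \<omega>|M. iexp (a * X \<omega>)) * (CLINT \<omega>|M. iexp (\<Sum>j\<in>J. b j * Y j \<omega>))"
        using integrable_mult_iexp[of "\<lambda>_. 1" "\<lambda>\<omega>. a * X \<omega> + (\<Sum>j\<in>J. b j * Y j \<omega>)" 1]
          integrable_mult_iexp[of "\<lambda>_. 1" "\<lambda>\<omega>. (\<Sum>j\<in>J. b j * Y j \<omega>)" 1]
        by (subst Bochner_Integration.integral_diff) auto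
      also have "\<dots> = 0" using factor[OF J] by simp
      finally show "(CLINT \<omega>|M. (iexp (a * X \<omega>) - (CLINT \<omega>|M. iexp (a * X \<omega>))) *
          iexp (\<Sum>j\<in>J. b j * Y j \<omega>)) = 0" .
    qed (use A in auto)
    have "(CLINT \<omega>|M. ((\<Prod>j\<in>J. indicator (A j) (Y j \<omega>)) - of_real p) * indicator B (X \<omega>)) = 0"
    proof (rule weight_orthogonal_iexp[where c = 2])
      fix \<omega>
      have "cmod (of_real p) \<le> 1" by (simp add: p_def)
      then show "cmod ((\<Prod>j\<in>J. indicator (A j) (Y j \<omega>)) - of_real p) \<le> 2"
        using bdprod[of \<omega>] norm_triangle_ineq4[of "\<Prod>j\<in>J. indicator (A j) (Y j \<omega>)" "complex_of_real p"]
        by simp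
    next
      fix a
      let ?e = "CLINT \<omega>|M. iexp (a * X \<omega>)"
      have i1: "integrable M (\<lambda>\<omega>. (\<Prod>j\<in>J. indicator (A j) (Y j \<omega>)) * iexp (a * X \<omega>))"
        by (rule integrable_mult_iexp[where c = 1]) (auto simp: bdprod)
      have i2: "integrable M (\<lambda>\<omega>. \<Prod>j\<in>J. indicator (A j) (Y j \<omega>) :: complex)"
        by (rule integrable_const_bound[where B = 1]) (auto simp: bdprod)
      have i3: "integrable M (\<lambda>\<omega>. iexp (a * X \<omega>))"
        using integrable_mult_iexp[of "\<lambda>_. 1" "\<lambda>\<omega>. a * X \<omega>" 1] by simp
      have "0 = (CLINT \<omega>|M. (\<Prod>j\<in>J. indicator (A j) (Y j \<omega>)) * iexp (a * X \<omega>) -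
          ?e * (\<Prod>j\<in>J. indicator (A j) (Y j \<omega>)))"
        unfolding zero1[of a, symmetric]
        by (rule Bochner_Integration.integral_cong) (auto simp: algebra_simps)
      also have "\<dots> = (CLINT \<omega>|M. (\<Prod>j\<in>J. indicator (A j) (Y j \<omega>)) * iexp (a * X \<omega>)) - ?e * p"
        using i1 i2 p_int by (subst Bochner_Integration.integral_diff) auto
      also have "\<dots> = (CLINT \<omega>|M. (\<Prod>j\<in>J. indicator (A j) (Y j \<omega>)) * iexp (a * X \<omega>) - p * iexp (a * X \<omega>))"
        using i1 i3 by (subst Bochner_Integration.integral_diff) auto
      also have "\<dots> = (CLINT \<omega>|M. ((\<Prod>j\<in>J. indicator (A j) (Y j \<omega>)) - of_real p) * iexp (a * X \<omega>))"
        by (rule Bochner_Integration.integral_cong) (auto simp: algebra_simps)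
      finally show "(CLINT \<omega>|M. ((\<Prod>j\<in>J. indicator (A j) (Y j \<omega>)) - of_real p) * iexp (a * X \<omega>)) = 0"
        by simp
    qed auto
    also have "(CLINT \<omega>|M. ((\<Prod>j\<in>J. indicator (A j) (Y j \<omega>)) - of_real p) * indicator B (X \<omega>)) =
      (CLINT \<omega>|M. of_real (indicator ({\<omega>\<in>space M. X \<omega> \<in> B} \<inter> {\<omega>\<in>space M. \<forall>j\<in>J. Y j \<omega> \<in> A j}) \<omega> -
          p * indicator {\<omega>\<in>space M. X \<omega> \<in> B} \<omega>))"
      using ind by (intro Bochner_Integration.integral_cong)
        (auto simp: indicator_def)
    also have "\<dots> = of_real (prob ({\<omega>\<in>space M. X \<omega> \<in> B} \<inter> {\<omega>\<in>space M. \<forall>j\<in>J. Y j \<omega> \<in> A j}) -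
          p * prob {\<omega>\<in>space M. X \<omega> \<in> B})"
      unfolding integral_complex_of_real
      by (subst Bochner_Integration.integral_diff) (auto simp: emeasure_eq_measure)
    finally show ?thesis by (simp add: p_def mult.commute flip: of_real_mult)
  qed
  have mYY: "(\<lambda>\<omega> i. Y i \<omega>) \<in> measurable M (Pi\<^sub>M UNIV (\<lambda>_. borel))"
    by (rule measurable_PiM_single') (auto simp: space_PiM)
  let ?A = "{X -` B \<inter> space M | B. B \<in> sets borel}"
  let ?P = "prod_algebra (UNIV :: 'i set) (\<lambda>_. borel :: real measure)"
  let ?G = "{(\<lambda>\<omega> i. Y i \<omega>) -` C \<inter> space M | C. C \<in> ?P}"
  have gen: "{(\<lambda>\<omega> i. Y i \<omega>) -` C \<inter> space M | C. C \<in> sets (Pi\<^sub>M UNIV (\<lambda>_. borel))} =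
      sigma_sets (space M) ?G"
    unfolding sets_PiM by (rule sigma_sets_vimage_commute) auto
  have "indep_set (sigma_sets (space M) ?A) (sigma_sets (space M) ?G)"
  proof (rule indep_set_sigma_sets)
    show "indep_set ?A ?G"
    proof (rule indep_setI)
      show "?A \<subseteq> events" by auto
      show "?G \<subseteq> events"
        using measurable_sets[OF mYY] by (auto simp: sets_PiM intro: sigma_sets.Basic)
      fix a b assume "a \<in> ?A" "b \<in> ?G"
      then obtain B C where B: "B \<in> sets borel" "a = X -` B \<inter> space M"
        and C: "C \<in> ?P" "b = (\<lambda>\<omega> i. Y i \<omega>) -` C \<inter> space M" by auto
      from C(1) obtain J E where J: "C = prod_emb UNIV (\<lambda>_. borel) J (\<Pi>\<^sub>E j\<in>J. E j)"
        "finite J" "\<And>i. i \<in> J \<Longrightarrow> E i \<in> sets borel"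
        by (rule prod_algebraE) auto
      have a: "a = {\<omega>\<in>space M. X \<omega> \<in> B}" using B by auto
      have b: "b = {\<omega>\<in>space M. \<forall>j\<in>J. Y j \<omega> \<in> E j}"
        using C(2) J(1) by (auto simp: prod_emb_def PiE_iff)
      show "prob (a \<inter> b) = prob a * prob b"
        unfolding a b using J B(1) by (intro cyl) auto
    qed
    show "Int_stable ?A"
    proof (rule Int_stableI)
      fix a b assume "a \<in> ?A" "b \<in> ?A"
      then obtain B C where "B \<in> sets borel" "a = X -` B \<inter> space M"
        "C \<in> sets borel" "b = X -` C \<inter> space M" by auto
      then show "a \<inter> b \<in> ?A" by (auto intro!: exI[of _ "B \<inter> C"])
    qed
    show "Int_stable ?G"
    proof (rule Int_stableI)
      fix a b assume "a \<in> ?G" "b \<in> ?G"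
      then obtain B C where BC: "B \<in> ?P" "a = (\<lambda>\<omega> i. Y i \<omega>) -` B \<inter> space M"
        "C \<in> ?P" "b = (\<lambda>\<omega> i. Y i \<omega>) -` C \<inter> space M" by auto
      moreover have "B \<inter> C \<in> ?P"
        using Int_stable_prod_algebra BC unfolding Int_stable_def by blast
      ultimately show "a \<inter> b \<in> ?G" by (auto intro!: exI[of _ "B \<inter> C"])
    qed
  qed
  note indep = indep_setD[OF this[folded gen]]
  interpret DX: prob_space "distr M borel X" by (rule prob_space_distr) measurable
  interpret DY: prob_space "distr M (Pi\<^sub>M UNIV (\<lambda>_. borel)) (\<lambda>\<omega> i. Y i \<omega>)"
    by (rule prob_space_distr) (rule mYY)
  show ?thesis
  proof (rule pair_measure_eqI)
    fix B C assume "B \<in> sets (distr M borel X)"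
      and "C \<in> sets (distr M (Pi\<^sub>M UNIV (\<lambda>_. borel)) (\<lambda>\<omega> i. Y i \<omega>))"
    then have B: "B \<in> sets borel" and C: "C \<in> sets (Pi\<^sub>M UNIV (\<lambda>_. borel))" by auto
    have "prob ((X -` B \<inter> space M) \<inter> ((\<lambda>\<omega> i. Y i \<omega>) -` C \<inter> space M)) =
      prob (X -` B \<inter> space M) * prob ((\<lambda>\<omega> i. Y i \<omega>) -` C \<inter> space M)"
      using B C by (intro indep) (auto intro: sigma_sets.Basic)
    moreover have "(\<lambda>\<omega>. (X \<omega>, \<lambda>i. Y i \<omega>)) -` (B \<times> C) \<inter> space M =
      (X -` B \<inter> space M) \<inter> ((\<lambda>\<omega> i. Y i \<omega>) -` C \<inter> space M)" by auto
    ultimately show "emeasure (distr M borel X) B *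
        emeasure (distr M (Pi\<^sub>M UNIV (\<lambda>_. borel)) (\<lambda>\<omega> i. Y i \<omega>)) C =
      emeasure (distr M (borel \<Otimes>\<^sub>M Pi\<^sub>M UNIV (\<lambda>_. borel)) (\<lambda>\<omega>. (X \<omega>, \<lambda>i. Y i \<omega>))) (B \<times> C)"
      using B C mYY
      by (subst (1 2 3) emeasure_distr)
        (auto simp: emeasure_eq_measure ennreal_mult intro!: measurable_Pair)
  qed (auto intro: DX.sigma_finite_measure_axioms DY.sigma_finite_measure_axioms)
qed

section \<open>Centered Gaussian processes\<close>

lemma (in prob_space) centered_gaussian_cases:
  assumes "gaussian_variable M X" "expectation X = 0"
  obtains "AE \<omega> in M. X \<omega> = 0"
  | \<sigma> where "\<sigma> > 0" "distributed M lborel X (normal_density 0 \<sigma>)"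
proof -
  have [measurable]: "X \<in> borel_measurable M"
    using assms by (simp add: gaussian_variable_def)
  consider \<mu> where "AE \<omega> in M. X \<omega> = \<mu>"
    | \<mu> \<sigma> where "\<sigma> > 0" "distributed M lborel X (normal_density \<mu> \<sigma>)"
    using assms(1) unfolding gaussian_variable_def by auto
  then show thesis
  proof cases
    case 1
    then have "expectation X = (LINT \<omega>|M. \<mu>)"
      by (intro integral_cong_AE) auto
    with assms(2) 1 that(1) show thesis by (simp add: prob_space)
  next
    case 2
    then have "expectation X = \<mu>" by (rule normal_distributed_expectation)
    with assms(2) 2 that(2) show thesis by simp
  qed
qed

text \<open>
  Degenerate variables are covered too: the formula then reads \<open>0 = 0\<close>, or \<open>1 = 1\<close> for \<open>m = 0\<close>.
\<close>

lemma (in prob_space) centered_gaussian_even_moment: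
  assumes X: "gaussian_variable M X" "expectation X = 0"
  shows integrable_centered_gaussian_power: "integrable M (\<lambda>\<omega>. X \<omega> ^ (2 * m))"
    and "expectation (\<lambda>\<omega>. X \<omega> ^ (2 * m)) =
      fact (2 * m) / (2 ^ m * fact m) * expectation (\<lambda>\<omega>. (X \<omega>)\<^sup>2) ^ m"
proof -
  have [measurable]: "X \<in> borel_measurable M"
    using X by (simp add: gaussian_variable_def)
  have "integrable M (\<lambda>\<omega>. X \<omega> ^ (2 * m)) \<and> expectation (\<lambda>\<omega>. X \<omega> ^ (2 * m)) =
      fact (2 * m) / (2 ^ m * fact m) * expectation (\<lambda>\<omega>. (X \<omega>)\<^sup>2) ^ m"
    using X
  proof (cases rule: centered_gaussian_cases)
    case 1
    have eq: "expectation (\<lambda>\<omega>. X \<omega> ^ (2 * k)) = (LINT \<omega>|M. 0 ^ (2 * k))" for k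
      using 1 by (intro integral_cong_AE) auto
    have "integrable M (\<lambda>\<omega>. X \<omega> ^ (2 * m)) \<longleftrightarrow> integrable M (\<lambda>\<omega>. 0 ^ (2 * m) :: real)"
      using 1 by (intro integrable_cong_AE) auto
    then have "integrable M (\<lambda>\<omega>. X \<omega> ^ (2 * m))" by (simp only: integrable_const)
    moreover have "expectation (\<lambda>\<omega>. X \<omega> ^ (2 * m)) = 0 ^ (2 * m)"
      unfolding eq by (simp add: prob_space)
    moreover have "expectation (\<lambda>\<omega>. (X \<omega>)\<^sup>2) = 0"
      using eq[of 1] by simp
    moreover have "(0::real) ^ (2 * m) = fact (2 * m) / (2 ^ m * fact m) * 0 ^ m"
    proof (cases "m = 0")
      case False
      then show ?thesis by (simp only: power_0_left mult_eq_0_iff) simp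
    qed simp
    ultimately show ?thesis by (simp only: simp_thms)
  next
    case (2 \<sigma>)
    have hb: "has_bochner_integral lborel (\<lambda>x. normal_density 0 \<sigma> x * x ^ (2 * k))
        (fact (2 * k) / ((2 / \<sigma>\<^sup>2) ^ k * fact k))" for k
      using normal_moment_even[OF 2(1), of 0 k] by (simp only: diff_zero)
    have int: "integrable M (\<lambda>\<omega>. X \<omega> ^ (2 * k))" for k
      using distributed_integrable[OF 2(2), of "\<lambda>x. x ^ (2 * k)"] hb[of k]
      by (auto simp: has_bochner_integral_iff)
    have ex: "expectation (\<lambda>\<omega>. X \<omega> ^ (2 * k)) = fact (2 * k) / ((2 / \<sigma>\<^sup>2) ^ k * fact k)" for k
      using distributed_integral[OF 2(2), of "\<lambda>x. x ^ (2 * k)"] hb[of k]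
      by (auto simp: has_bochner_integral_iff)
    have "expectation (\<lambda>\<omega>. (X \<omega>)\<^sup>2) = \<sigma>\<^sup>2"
      using ex[of 1] by simp
    then show ?thesis
      using int[of m] ex[of m]
      by (simp only: power_divide times_divide_eq_left times_divide_eq_right divide_divide_eq_right
          mult_ac simp_thms)
  qed
  then show "integrable M (\<lambda>\<omega>. X \<omega> ^ (2 * m))"
    and "expectation (\<lambda>\<omega>. X \<omega> ^ (2 * m)) =
      fact (2 * m) / (2 ^ m * fact m) * expectation (\<lambda>\<omega>. (X \<omega>)\<^sup>2) ^ m"
    by (rule conjunct1, rule conjunct2)
qed

lemma (in prob_space) centered_gaussian_char:
  assumes X: "gaussian_variable M X" "expectation X = 0"
  shows "(CLINT \<omega>|M. iexp (X \<omega>)) = of_real (exp (- expectation (\<lambda>\<omega>. (X \<omega>)\<^sup>2) / 2))"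
  using X
proof (cases rule: centered_gaussian_cases)
  have [measurable]: "X \<in> borel_measurable M"
    using X by (simp add: gaussian_variable_def)
  case 1
  have "(CLINT \<omega>|M. iexp (X \<omega>)) = (CLINT \<omega>|M. 1)"
    using 1 by (intro integral_cong_AE) auto
  moreover have "expectation (\<lambda>\<omega>. (X \<omega>)\<^sup>2) = (LINT \<omega>|M. 0)"
    using 1 by (intro integral_cong_AE) auto
  ultimately show ?thesis by (simp add: prob_space)
next
  have [measurable]: "X \<in> borel_measurable M"
    using X by (simp add: gaussian_variable_def)
  case (2 \<sigma>)
  have var: "expectation (\<lambda>\<omega>. (X \<omega>)\<^sup>2) = \<sigma>\<^sup>2"
    using normal_distributed_variance[OF 2] X by simp
  have std: "distributed M lborel (\<lambda>\<omega>. X \<omega> / \<sigma>) std_normal_density"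
    using 2 normal_standard_normal_convert[of \<sigma> X 0] by simp
  have "(CLINT \<omega>|M. iexp (X \<omega>)) = (CLINT \<omega>|M. iexp (\<sigma> * (X \<omega> / \<sigma>)))"
    using 2 by simp
  also have "\<dots> = (CLINT x|distr M lborel (\<lambda>\<omega>. X \<omega> / \<sigma>). iexp (\<sigma> * x))"
    by (subst integral_distr) auto
  also have "distr M lborel (\<lambda>\<omega>. X \<omega> / \<sigma>) = std_normal_distribution"
    using std by (simp add: distributed_def)
  also have "(CLINT x|std_normal_distribution. iexp (\<sigma> * x)) = char std_normal_distribution \<sigma>"
    by (simp add: char_def)
  finally show ?thesis by (simp add: char_std_normal_distribution var)
qed

definition linear_combinations :: "('t \<Rightarrow> 'w \<Rightarrow> real) \<Rightarrow> ('w \<Rightarrow> real) set" where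
  "linear_combinations B = {X. \<exists>T c. finite T \<and> X = (\<lambda>\<omega>. \<Sum>t\<in>T. c t * B t \<omega>)}"

lemma linear_combinations_base: "B t \<in> linear_combinations B"
  unfolding linear_combinations_def mem_Collect_eq
  by (rule exI[of _ "{t}"], rule exI[of _ "\<lambda>_. 1"]) simp

lemma linear_combinations_zero: "(\<lambda>\<omega>. 0) \<in> linear_combinations B"
  unfolding linear_combinations_def mem_Collect_eq
  by (rule exI[of _ "{}"], rule exI[of _ "\<lambda>_. 0"]) simp

lemma linear_combinations_scale:
  assumes "X \<in> linear_combinations B"
  shows "(\<lambda>\<omega>. a * X \<omega>) \<in> linear_combinations B"
proof -
  obtain T c where T: "finite T" "X = (\<lambda>\<omega>. \<Sum>t\<in>T. c t * B t \<omega>)"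
    using assms by (auto simp: linear_combinations_def)
  have "(\<lambda>\<omega>. a * X \<omega>) = (\<lambda>\<omega>. \<Sum>t\<in>T. (a * c t) * B t \<omega>)"
    unfolding T(2) by (simp add: sum_distrib_left mult.assoc)
  then show ?thesis
    unfolding linear_combinations_def mem_Collect_eq
    by (intro exI[of _ T] exI[of _ "\<lambda>t. a * c t"] conjI T(1))
qed

lemma linear_combinations_add:
  assumes "X \<in> linear_combinations B" "Y \<in> linear_combinations B"
  shows "(\<lambda>\<omega>. X \<omega> + Y \<omega>) \<in> linear_combinations B"
proof -
  obtain S c T d where S: "finite S" "X = (\<lambda>\<omega>. \<Sum>t\<in>S. c t * B t \<omega>)"
    and T: "finite T" "Y = (\<lambda>\<omega>. \<Sum>t\<in>T. d t * B t \<omega>)"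
    using assms by (auto simp: linear_combinations_def)
  define e where "e t = (if t \<in> S then c t else 0) + (if t \<in> T then d t else 0)" for t
  have "(\<Sum>t\<in>S. c t * B t \<omega>) = (\<Sum>t\<in>S \<union> T. (if t \<in> S then c t else 0) * B t \<omega>)" for \<omega>
    using S T by (intro sum.mono_neutral_cong_left) auto
  moreover have "(\<Sum>t\<in>T. d t * B t \<omega>) = (\<Sum>t\<in>S \<union> T. (if t \<in> T then d t else 0) * B t \<omega>)" for \<omega>
    using S T by (intro sum.mono_neutral_cong_left) auto
  ultimately have "(\<lambda>\<omega>. X \<omega> + Y \<omega>) = (\<lambda>\<omega>. \<Sum>t\<in>S \<union> T. e t * B t \<omega>)"
    unfolding S(2) T(2) e_def by (simp add: distrib_right sum.distrib)
  then show ?thesis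
    unfolding linear_combinations_def mem_Collect_eq
    by (intro exI[of _ "S \<union> T"] exI[of _ e] conjI finite_UnI S(1) T(1))
qed

lemma linear_combinations_diff:
  assumes "X \<in> linear_combinations B" "Y \<in> linear_combinations B"
  shows "(\<lambda>\<omega>. X \<omega> - Y \<omega>) \<in> linear_combinations B"
proof -
  have "(\<lambda>\<omega>. X \<omega> + -1 * Y \<omega>) \<in> linear_combinations B"
    by (intro linear_combinations_add linear_combinations_scale assms)
  then show ?thesis by simp
qed

lemma linear_combinations_sum:
  assumes "\<And>i. i \<in> I \<Longrightarrow> X i \<in> linear_combinations B"
  shows "(\<lambda>\<omega>. \<Sum>i\<in>I. X i \<omega>) \<in> linear_combinations B"
  using assms
proof (induction I rule: infinite_finite_induct)
  case (insert i I)
  then show ?case by (simp add: linear_combinations_add)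
qed (simp_all add: linear_combinations_zero)

lemma integrable_normal_distributed:
  assumes "\<sigma> > 0" "distributed M lborel X (normal_density \<mu> \<sigma>)"
  shows "integrable M X"
  using distributed_integrable[OF assms(2), of "\<lambda>x. x"] integrable_normal_moment_nz_1[OF assms(1), of \<mu>]
  by simp

locale centered_gaussian_process = prob_space M for M :: "'w measure" +
  fixes B :: "'t \<Rightarrow> 'w \<Rightarrow> real"
  assumes gaussian: "gaussian_process M B"
    and centered: "\<And>t. expectation (B t) = 0"
begin

lemma gaussian_combination:
  assumes "X \<in> linear_combinations B"
  shows "gaussian_variable M X"
proof -
  obtain T c where T: "finite T" "X = (\<lambda>\<omega>. \<Sum>t\<in>T. c t * B t \<omega>)"
    using assms by (auto simp: linear_combinations_def)
  show ?thesis
    unfolding T(2) by (rule gaussian[unfolded gaussian_process_def, rule_format, OF T(1)])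
qed

lemma measurable_combination:
  assumes "X \<in> linear_combinations B"
  shows "X \<in> borel_measurable M"
  using gaussian_combination[OF assms] by (simp add: gaussian_variable_def)

lemma integrable_combination:
  assumes X: "X \<in> linear_combinations B"
  shows "integrable M X"
proof -
  note [measurable] = measurable_combination[OF X]
  consider \<mu> where "AE \<omega> in M. X \<omega> = \<mu>"
    | \<mu> \<sigma> where "\<sigma> > 0" "distributed M lborel X (normal_density \<mu> \<sigma>)"
    using gaussian_combination[OF X] unfolding gaussian_variable_def by auto
  then show ?thesis
  proof cases
    case 1
    then have "integrable M X \<longleftrightarrow> integrable M (\<lambda>\<omega>. \<mu>)"
      by (intro integrable_cong_AE) auto
    then show ?thesis by simp
  qed (rule integrable_normal_distributed)
qed

lemma centered_combination:
  assumes "X \<in> linear_combinations B"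
  shows "expectation X = 0"
proof -
  obtain T c where T: "finite T" "X = (\<lambda>\<omega>. \<Sum>t\<in>T. c t * B t \<omega>)"
    using assms by (auto simp: linear_combinations_def)
  show ?thesis
    unfolding T(2)
    by (subst Bochner_Integration.integral_sum)
      (auto simp: centered intro!: integrable_combination linear_combinations_base)
qed

lemma integrable_combination_mult:
  assumes X: "X \<in> linear_combinations B" and Y: "Y \<in> linear_combinations B"
  shows "integrable M (\<lambda>\<omega>. X \<omega> * Y \<omega>)"
proof -
  have sq: "integrable M (\<lambda>\<omega>. (Z \<omega>)\<^sup>2)" if "Z \<in> linear_combinations B" for Z
    using integrable_centered_gaussian_power[OF gaussian_combination centered_combination, OF that that, of 1]
    by simp
  have "integrable M (\<lambda>\<omega>. ((X \<omega> + Y \<omega>)\<^sup>2 - (X \<omega>)\<^sup>2 - (Y \<omega>)\<^sup>2) / 2)"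
    using sq[OF X] sq[OF Y] sq[OF linear_combinations_add[OF X Y]] by auto
  moreover have "((X \<omega> + Y \<omega>)\<^sup>2 - (X \<omega>)\<^sup>2 - (Y \<omega>)\<^sup>2) / 2 = X \<omega> * Y \<omega>" for \<omega>
    by (simp add: power2_sum)
  ultimately show ?thesis by (simp only:)
qed

text \<open>
  Within the linear span of a Gaussian process the second moment determines the characteristic
  function, and second moments of uncorrelated elements add up.
\<close>

lemma char_uncorrelated:
  assumes X: "X \<in> linear_combinations B" and Y: "Y \<in> linear_combinations B"
    and uncorrelated: "expectation (\<lambda>\<omega>. X \<omega> * Y \<omega>) = 0"
  shows "(CLINT \<omega>|M. iexp (a * X \<omega> + Y \<omega>)) = (CLINT \<omega>|M. iexp (a * X \<omega>)) * (CLINT \<omega>|M. iexp (Y \<omega>))"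
proof -
  note aX = linear_combinations_scale[OF X, of a]
  note char = centered_gaussian_char[OF gaussian_combination centered_combination]
  let ?V = "\<lambda>Z. expectation (\<lambda>\<omega>. Z \<omega> * Z \<omega>)"
  have "?V (\<lambda>\<omega>. a * X \<omega> + Y \<omega>) =
      expectation (\<lambda>\<omega>. (a * X \<omega>) * (a * X \<omega>) + (2 * a * (X \<omega> * Y \<omega>) + Y \<omega> * Y \<omega>))"
    by (rule Bochner_Integration.integral_cong) (auto simp: algebra_simps)
  also have "\<dots> = ?V (\<lambda>\<omega>. a * X \<omega>) + (2 * a * expectation (\<lambda>\<omega>. X \<omega> * Y \<omega>) + ?V Y)"
    by (simp only: Bochner_Integration.integral_add Bochner_Integration.integrable_add
        integrable_mult_right integral_mult_right_zero
        integrable_combination_mult[OF aX aX] integrable_combination_mult[OF X Y]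
        integrable_combination_mult[OF Y Y])
  finally have V: "?V (\<lambda>\<omega>. a * X \<omega> + Y \<omega>) = ?V (\<lambda>\<omega>. a * X \<omega>) + ?V Y"
    unfolding uncorrelated by simp
  have "exp (- ?V (\<lambda>\<omega>. a * X \<omega> + Y \<omega>) / 2) = exp (- ?V (\<lambda>\<omega>. a * X \<omega>) / 2) * exp (- ?V Y / 2)"
    unfolding V exp_add[symmetric] minus_add_distrib add_divide_distrib ..
  then show ?thesis
    unfolding char[OF linear_combinations_add[OF aX Y] linear_combinations_add[OF aX Y]]
      char[OF aX aX] char[OF Y Y] power2_eq_square of_real_mult[symmetric]
    by (rule arg_cong)
qed

end

section \<open>Linear growth of fractional Brownian fields\<close>

lemma fbf_centered_gaussian:
  assumes "prob_space M" "fractional_brownian_field M H B"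
  shows "centered_gaussian_process M B"
proof -
  interpret prob_space M by fact
  show ?thesis
  proof
    show "gaussian_process M B" and "expectation (B t) = 0" for t
      using assms(2) unfolding fractional_brownian_field_def by blast+
  qed
qed

lemma fbf_increment_second_moment:
  assumes "prob_space M" "fractional_brownian_field M H B"
  shows "(LINT \<omega>|M. (B t \<omega> - B s \<omega>)\<^sup>2) = norm (t - s) powr (2 * H)"
proof -
  interpret centered_gaussian_process M B
    using assms by (rule fbf_centered_gaussian)
  have "expectation (\<lambda>\<omega>. B t \<omega> - B s \<omega>) = 0"
    by (intro centered_combination linear_combinations_diff linear_combinations_base)
  moreover have "variance (\<lambda>\<omega>. B t \<omega> - B s \<omega>) = norm (t - s) powr (2 * H)"
    using assms(2) by (simp add: fractional_brownian_field_def)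
  ultimately show ?thesis by simp
qed

text \<open>
  \<open>grid_point N i\<close> scales the integer lattice to mesh \<open>2 ^ N / 2 ^ i\<close>: level \<open>i\<close> of the dyadic
  grid for the cube of half side \<open>2 ^ N\<close>.
\<close>

definition grid_point :: "nat \<Rightarrow> nat \<Rightarrow> int ^ 'n \<Rightarrow> real ^ 'n" where
  "grid_point N i y = (\<chi> k. 2 ^ N / 2 ^ i * real_of_int (y $ k))"

text \<open>
  Rounding towards zero, so that every address inside the open cube has the origin as its
  ancestor at level 0. There the field vanishes, and the chain needs no separate starting value.
\<close>

definition parent :: "int ^ 'n \<Rightarrow> int ^ 'n" where
  "parent y = (\<chi> k. sgn (y $ k) * (\<bar>y $ k\<bar> div 2))"

definition address :: "nat \<Rightarrow> nat \<Rightarrow> real ^ 'n \<Rightarrow> int ^ 'n" where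
  "address N i t = (\<chi> k. (if t $ k < 0 then - 1 else 1) * \<lfloor>2 ^ i * \<bar>t $ k\<bar> / 2 ^ N\<rfloor>)"

definition int_box :: "int \<Rightarrow> (int ^ 'n) set" where
  "int_box m = {y. \<forall>k. \<bar>y $ k\<bar> \<le> m}"

lemma int_box_finite_card:
  assumes "0 \<le> m"
  shows finite_int_box: "finite (int_box m :: (int ^ 'n) set)"
    and card_int_box: "real (card (int_box m :: (int ^ 'n) set)) \<le> (2 * real_of_int m + 1) ^ CARD('n)"
proof -
  let ?F = "\<Pi>\<^sub>E k\<in>(UNIV :: 'n set). {- m..m}"
  have sub: "(int_box m :: (int ^ 'n) set) \<subseteq> vec_lambda ` ?F"
  proof
    fix y :: "int ^ 'n" assume y: "y \<in> int_box m"
    then have "vec_nth y \<in> ?F"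
      by (auto simp: int_box_def abs_le_iff minus_le_iff)
    then show "y \<in> vec_lambda ` ?F"
      by (intro image_eqI[where x = "vec_nth y"]) (simp add: vec_nth_inverse)
  qed
  have fin: "finite ?F" by (intro finite_PiE) auto
  show "finite (int_box m :: (int ^ 'n) set)"
    by (rule finite_subset[OF sub]) (intro finite_imageI fin)
  have "card (int_box m :: (int ^ 'n) set) \<le> card (vec_lambda ` ?F)"
    by (intro card_mono sub finite_imageI fin)
  also have "\<dots> \<le> card ?F" by (rule card_image_le[OF fin])
  also have "card ?F = nat (2 * m + 1) ^ CARD('n)"
    by (simp add: card_PiE)
  finally have "real (card (int_box m :: (int ^ 'n) set)) \<le> real (nat (2 * m + 1) ^ CARD('n))"
    by (rule of_nat_mono)
  also have "\<dots> = (2 * real_of_int m + 1) ^ CARD('n)"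
    using assms by simp
  finally show "real (card (int_box m :: (int ^ 'n) set)) \<le> (2 * real_of_int m + 1) ^ CARD('n)" .
qed

lemma norm_grid_point_parent:
  fixes y :: "int ^ 'n"
  shows "norm (grid_point N (Suc i) y - grid_point N i (parent y)) \<le> real CARD('n) * 2 ^ N / 2 ^ i"
proof -
  have coord: "\<bar>(grid_point N (Suc i) y - grid_point N i (parent y)) $ k\<bar> \<le> 2 ^ N / 2 ^ i" for k
  proof -
    have "\<bar>y $ k - 2 * (sgn (y $ k) * (\<bar>y $ k\<bar> div 2))\<bar> \<le> 1"
      by (cases "y $ k" "0 :: int" rule: linorder_cases) (auto simp: sgn_if)
    then have *: "\<bar>real_of_int (y $ k - 2 * (sgn (y $ k) * (\<bar>y $ k\<bar> div 2)))\<bar> \<le> 1"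
      using of_int_le_iff[of "\<bar>y $ k - 2 * (sgn (y $ k) * (\<bar>y $ k\<bar> div 2))\<bar>" 1, where 'a = real]
      by (simp only: of_int_abs of_int_1)
    have "(grid_point N (Suc i) y - grid_point N i (parent y)) $ k =
      2 ^ N / 2 ^ Suc i * real_of_int (y $ k - 2 * (sgn (y $ k) * (\<bar>y $ k\<bar> div 2)))"
      by (simp add: grid_point_def parent_def field_simps)
    also have "\<bar>\<dots>\<bar> \<le> 2 ^ N / 2 ^ Suc i * 1"
      unfolding abs_mult using * by (intro mult_mono) auto
    also have "\<dots> \<le> 2 ^ N / 2 ^ i" by (simp add: field_simps)
    finally show ?thesis .
  qed
  have "norm (grid_point N (Suc i) y - grid_point N i (parent y)) \<le>
      (\<Sum>k\<in>UNIV. \<bar>(grid_point N (Suc i) y - grid_point N i (parent y)) $ k\<bar>)"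
    by (rule norm_le_l1_cart)
  also have "\<dots> \<le> (\<Sum>k\<in>(UNIV :: 'n set). 2 ^ N / 2 ^ i)"
    by (intro sum_mono coord)
  finally show ?thesis by simp
qed

lemma parent_address: "parent (address N (Suc i) t) = address N i t"
proof -
  have "sgn (c * \<lfloor>2 * x\<rfloor>) * (\<bar>c * \<lfloor>2 * x\<rfloor>\<bar> div 2) = c * \<lfloor>x\<rfloor>"
    if c: "c = 1 \<or> c = - 1" and x: "0 \<le> x" for c :: int and x :: real
  proof -
    have half: "\<lfloor>x\<rfloor> = \<lfloor>2 * x\<rfloor> div 2"
      using floor_divide_real_eq_div[of 2 "2 * x"] by simp
    have "sgn (c * z) * (\<bar>c * z\<bar> div 2) = c * (z div 2)" if "0 \<le> z" for z :: int
      using that c by (cases "z = 0") (auto simp: sgn_if)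
    then show ?thesis unfolding half using x by simp
  qed
  from this[of "if t $ k < 0 then - 1 else 1" "2 ^ i * \<bar>t $ k\<bar> / 2 ^ N" for k] show ?thesis
    by (simp add: parent_def address_def vec_eq_iff mult.assoc)
qed

lemma address_in_box:
  assumes "\<And>k. \<bar>t $ k\<bar> \<le> 2 ^ N"
  shows "address N i t \<in> int_box (2 ^ i)"
proof -
  have "\<bar>(if t $ k < 0 then - 1 else 1) * \<lfloor>2 ^ i * \<bar>t $ k\<bar> / 2 ^ N\<rfloor>\<bar> \<le> (2 :: int) ^ i" for k
  proof -
    have "2 ^ i * \<bar>t $ k\<bar> / 2 ^ N \<le> 2 ^ i"
      using assms[of k] by (simp add: field_simps)
    then have "\<lfloor>2 ^ i * \<bar>t $ k\<bar> / 2 ^ N\<rfloor> \<le> (2 :: int) ^ i"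
      by (subst floor_le_iff) simp
    moreover have "0 \<le> \<lfloor>2 ^ i * \<bar>t $ k\<bar> / 2 ^ N\<rfloor>" by simp
    ultimately show ?thesis by (cases "t $ k < 0") (simp_all only: abs_of_nonneg if_True if_False abs_minus_cancel mult_minus_left mult_1_left)
  qed
  then show ?thesis by (simp add: address_def int_box_def)
qed

lemma grid_point_address_tendsto:
  "(\<lambda>i. grid_point N i (address N i t)) \<longlonglongrightarrow> t"
proof (rule vec_tendstoI)
  fix k
  have err: "\<bar>grid_point N i (address N i t) $ k - t $ k\<bar> \<le> 2 ^ N * (1 / 2) ^ i" for i
  proof -
    define x where "x = 2 ^ i * \<bar>t $ k\<bar> / 2 ^ N"
    define s where "s = (if t $ k < 0 then - 1 else 1 :: real)"
    have t: "t $ k = 2 ^ N / 2 ^ i * (s * x)"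
      by (simp add: x_def s_def)
    have g: "grid_point N i (address N i t) $ k = 2 ^ N / 2 ^ i * (s * of_int \<lfloor>x\<rfloor>)"
      by (simp add: grid_point_def address_def x_def s_def)
    have "\<bar>s * of_int \<lfloor>x\<rfloor> - s * x\<bar> \<le> 1"
      unfolding s_def by (simp add: abs_le_iff; linarith)
    then have "2 ^ N / 2 ^ i * \<bar>s * of_int \<lfloor>x\<rfloor> - s * x\<bar> \<le> 2 ^ N / 2 ^ i * 1"
      by (intro mult_left_mono) auto
    moreover have "grid_point N i (address N i t) $ k - t $ k = 2 ^ N / 2 ^ i * (s * of_int \<lfloor>x\<rfloor> - s * x)"
      unfolding g by (subst t) (simp add: right_diff_distrib)
    ultimately show ?thesis by (simp add: abs_mult power_one_over)
  qed
  have "(\<lambda>i. 2 ^ N * (1 / 2) ^ i) \<longlonglongrightarrow> (2 ^ N * 0 :: real)"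
    by (intro tendsto_intros) auto
  then have lim: "(\<lambda>i. 2 ^ N * (1 / 2) ^ i :: real) \<longlonglongrightarrow> 0" by simp
  have "(\<lambda>i. grid_point N i (address N i t) $ k - t $ k) \<longlonglongrightarrow> 0"
    by (rule Lim_null_comparison[OF always_eventually lim]) (simp only: real_norm_def err simp_thms)
  then show "(\<lambda>i. grid_point N i (address N i t) $ k) \<longlonglongrightarrow> t $ k"
    by (simp add: LIM_zero_iff)
qed

text \<open>
  For \<open>norm t < 2 ^ N\<close> the addresses of \<open>t\<close> form a chain from the origin to \<open>t\<close>. Summing the
  geometric bounds along it gives \<open>\<bar>f t\<bar> \<le> C * 2 ^ N / (1 - r)\<close>, and the least such \<open>N\<close> has
  \<open>2 ^ N \<le> 2 * (1 + norm t)\<close>.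
\<close>

lemma linear_growth_of_chain_bound:
  fixes f :: "real ^ 'n \<Rightarrow> real"
  assumes cont: "continuous_on UNIV f" and f0: "f 0 = 0"
    and r: "0 < r" "r < 1" and C: "0 \<le> C"
    and chain: "\<And>N i y. y \<in> int_box (2 ^ Suc i) \<Longrightarrow>
      \<bar>f (grid_point N (Suc i) y) - f (grid_point N i (parent y))\<bar> \<le> C * 2 ^ N * r ^ i"
  shows "\<exists>A\<ge>0. \<forall>t. \<bar>f t\<bar> \<le> A * (1 + norm t)"
proof (intro exI conjI allI)
  show "0 \<le> 2 * C / (1 - r)" using r C by simp
  fix t :: "real ^ 'n"
  have "\<exists>N. norm t < 2 ^ N" by (rule real_arch_pow) simp
  then obtain N where N: "norm t < 2 ^ N" and min: "\<And>K. K < N \<Longrightarrow> \<not> norm t < 2 ^ K"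
    using exists_least_iff[of "\<lambda>N. norm t < 2 ^ N"] by auto
  \<comment> \<open>If \<open>N = 0\<close> the truncated \<open>N - 1\<close> is harmless: the bound is then \<open>1 \<le> 2 * (1 + norm t)\<close>.\<close>
  have N2: "2 ^ N \<le> 2 * (1 + norm t)"
    using min[of "N - 1"] by (cases N) auto
  have tk: "\<bar>t $ k\<bar> < 2 ^ N" for k
    using component_le_norm_cart[of t k] N by linarith
  let ?p = "\<lambda>i. grid_point N i (address N i t)"
  have "\<lfloor>\<bar>t $ k\<bar> / 2 ^ N\<rfloor> = 0" for k
    using tk[of k] by (simp add: floor_eq_iff field_simps)
  then have "?p 0 = 0"
    by (simp add: grid_point_def address_def vec_eq_iff)
  then have p0: "f (?p 0) = 0" using f0 by simp
  have step: "\<bar>f (?p (Suc i)) - f (?p i)\<bar> \<le> C * 2 ^ N * r ^ i" for i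
    using chain[OF address_in_box[of t N "Suc i"], of N] tk less_imp_le
    by (auto simp: parent_address)
  have bound: "\<bar>f (?p i)\<bar> \<le> C * 2 ^ N / (1 - r)" for i
  proof -
    have "f (?p i) = (\<Sum>j<i. f (?p (Suc j)) - f (?p j))"
      using sum_lessThan_telescope[of "\<lambda>j. f (?p j)" i] p0 by simp
    also have "\<bar>\<dots>\<bar> \<le> (\<Sum>j<i. C * 2 ^ N * r ^ j)"
      by (rule order_trans[OF sum_abs]) (intro sum_mono step)
    also have "\<dots> = C * 2 ^ N * (\<Sum>j<i. r ^ j)" by (simp add: sum_distrib_left)
    also have "\<dots> \<le> C * 2 ^ N * (1 / (1 - r))"
    proof (intro mult_left_mono)
      have "(\<Sum>j<i. r ^ j) \<le> (\<Sum>j. r ^ j)"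
        using r by (intro sum_le_suminf summable_geometric) auto
      then show "(\<Sum>j<i. r ^ j) \<le> 1 / (1 - r)"
        using r by (simp add: suminf_geometric)
    qed (use C in auto)
    finally show ?thesis by simp
  qed
  have "(\<lambda>i. f (?p i)) \<longlonglongrightarrow> f t"
    using continuous_on_tendsto_compose[OF cont grid_point_address_tendsto] by simp
  then have "(\<lambda>i. \<bar>f (?p i)\<bar>) \<longlonglongrightarrow> \<bar>f t\<bar>" by (rule tendsto_rabs)
  then have "\<bar>f t\<bar> \<le> C * 2 ^ N / (1 - r)"
    by (rule LIMSEQ_le_const2) (use bound in auto)
  also have "\<dots> \<le> C * (2 * (1 + norm t)) / (1 - r)"
    using N2 C r by (intro divide_right_mono mult_left_mono) auto
  finally show "\<bar>f t\<bar> \<le> 2 * C / (1 - r) * (1 + norm t)" by (simp add: mult_ac)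
qed

text \<open>
  The sum of the \<open>2 * m\<close>-th moments of all normalised increments is finite for large \<open>m\<close>: level
  \<open>i\<close> has of the order of \<open>2 ^ (i * n)\<close> increments, each contributing a constant times
  \<open>2 powr (- H * m * i) * 2 powr ((2 * H - 2) * m * N)\<close>. So almost surely the sum itself is
  finite, and it bounds each of its terms.
\<close>

lemma fbf_chain_bound:
  fixes B :: "real ^ 'n \<Rightarrow> 'w \<Rightarrow> real"
  assumes "prob_space M" and H: "0 < H" "H < 1" and B: "fractional_brownian_field M H B"
  defines "r \<equiv> 2 powr (- H / 2)"
  shows "AE \<omega> in M. \<exists>C\<ge>0. \<forall>N i. \<forall>y\<in>int_box (2 ^ Suc i).
    \<bar>B (grid_point N (Suc i) y) \<omega> - B (grid_point N i (parent y)) \<omega>\<bar> \<le> C * 2 ^ N * r ^ i"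
proof -
  interpret centered_gaussian_process M B
    using assms(1) B by (rule fbf_centered_gaussian)
  let ?n = "CARD('n)"
  define q where "q = 2 powr (- H)"
  have q: "0 < q" "q < 1" using H by (auto simp: q_def powr_less_one)
  \<comment> \<open>The moment is chosen to beat the number of grid points, which grows like \<open>2 ^ (i * ?n)\<close>.\<close>
  obtain m where "q ^ m < 1 / 2 ^ ?n"
    using real_arch_pow_inv[of "1 / 2 ^ ?n" q] q by auto
  then have m: "2 ^ ?n * q ^ m < 1" by (simp add: field_simps)
  have m0: "m > 0"
  proof (rule ccontr)
    assume "\<not> m > 0"
    then have "(2 :: real) ^ ?n < 1" using m by simp
    then show False using one_le_power[of "2 :: real" ?n] by linarith
  qed
  define \<theta> where "\<theta> = 2 ^ ?n * q ^ m"
  define \<rho> where "\<rho> = (2 powr (2 * H - 2)) ^ m"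
  have \<theta>: "0 \<le> \<theta>" "\<theta> < 1" using m q by (auto simp: \<theta>_def)
  have \<rho>: "0 \<le> \<rho>" "\<rho> < 1"
    using H m0 by (auto simp: \<rho>_def power_less_one_iff powr_less_one)
  define c :: real where "c = fact (2 * m) / (2 ^ m * fact m)"
  have c: "0 \<le> c" unfolding c_def by (intro divide_nonneg_pos mult_pos_pos) auto
  define K where "K = 8 ^ ?n * c * (real ?n powr (2 * H)) ^ m"
  have K: "0 \<le> K" using c by (simp add: K_def)
  have r: "0 < r" by (simp add: r_def)
  define D where "D N i y \<omega> = B (grid_point N (Suc i) y) \<omega> - B (grid_point N i (parent y)) \<omega>" for N i y \<omega>
  define Z where "Z N i y \<omega> = (D N i y \<omega> / (2 ^ N * r ^ i)) ^ (2 * m)" for N i y \<omega>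
  have D_comb: "D N i y \<in> linear_combinations B" for N i y
    unfolding D_def[abs_def] by (intro linear_combinations_diff linear_combinations_base)
  have [measurable]: "Z N i y \<in> borel_measurable M" for N i y
    unfolding Z_def[abs_def] using measurable_combination[OF D_comb] by measurable
  have Z_nonneg: "0 \<le> Z N i y \<omega>" for N i y \<omega>
    by (simp add: Z_def power_mult)
  have EZ: "(\<integral>\<^sup>+\<omega>. ennreal (Z N i y \<omega>) \<partial>M) \<le> ennreal (c * (real ?n powr (2 * H)) ^ m * \<rho> ^ N * (q ^ m) ^ i)"
    for N i y
  proof -
    note mom = centered_gaussian_even_moment[OF gaussian_combination centered_combination, OF D_comb D_comb,
        of N i y m, folded c_def]
    have "expectation (\<lambda>\<omega>. (D N i y \<omega>)\<^sup>2) =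
        norm (grid_point N (Suc i) y - grid_point N i (parent y)) powr (2 * H)"
      unfolding D_def using fbf_increment_second_moment[OF assms(1) B] .
    also have "\<dots> \<le> (real ?n * 2 ^ N / 2 ^ i) powr (2 * H)"
      using H by (intro powr_mono2 norm_grid_point_parent) auto
    finally have var: "expectation (\<lambda>\<omega>. (D N i y \<omega>)\<^sup>2) \<le> (real ?n * 2 ^ N / 2 ^ i) powr (2 * H)" .
    have pw: "(real ?n * 2 ^ N / 2 ^ i) powr (2 * H) / (2 ^ N * r ^ i)\<^sup>2 =
        real ?n powr (2 * H) * (2 powr (2 * H - 2)) ^ N * q ^ i"
    proof -
      have "(real ?n * 2 ^ N / 2 ^ i) powr (2 * H) =
          real ?n powr (2 * H) * (2 powr real N) powr (2 * H) / (2 powr real i) powr (2 * H)"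
        by (simp add: powr_mult powr_divide powr_realpow)
      also have "\<dots> = real ?n powr (2 * H) * (2 powr (2 * H * N)) / (2 powr (2 * H * i))"
        by (simp add: powr_powr mult_ac)
      finally have 1: "(real ?n * 2 ^ N / 2 ^ i) powr (2 * H) =
          real ?n powr (2 * H) * (2 powr (2 * H * N)) / (2 powr (2 * H * i))" .
      have r_pow: "r ^ i = 2 powr (real i * (- H / 2))"
        unfolding r_def by (rule powr_power) simp
      have two_pow: "(2 :: real) ^ N = 2 powr real N"
        by (simp add: powr_realpow)
      have "(2 ^ N * r ^ i)\<^sup>2 = 2 powr (real 2 * (real N + real i * (- H / 2)))"
        unfolding r_pow two_pow powr_add[symmetric] by (rule powr_power) simp
      also have "real 2 * (real N + real i * (- H / 2)) = 2 * N - H * i"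
        by (simp add: algebra_simps)
      finally have 2: "(2 ^ N * r ^ i)\<^sup>2 = 2 powr (2 * N - H * i)" .
      have "(2 powr (2 * H - 2)) ^ N = 2 powr (real N * (2 * H - 2))" "q ^ i = 2 powr (real i * (- H))"
        unfolding q_def by (rule powr_power, simp)+
      then have 3: "(2 powr (2 * H - 2)) ^ N * q ^ i = 2 powr (real N * (2 * H - 2) + real i * (- H))"
        by (simp only: powr_add)
      have "2 powr (2 * H * N) / 2 powr (2 * H * i) / 2 powr (2 * N - H * i) =
          2 powr (real N * (2 * H - 2) + real i * (- H))"
        unfolding powr_diff[symmetric] by (rule arg_cong[where f = "\<lambda>z. 2 powr z"]) (simp add: algebra_simps)
      then show ?thesis
        unfolding 1 2 mult.assoc 3 by (simp only: times_divide_eq_right[symmetric])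
    qed
    have "integrable M (Z N i y)"
      unfolding Z_def[abs_def] power_divide by (intro integrable_divide_zero mom(1))
    then have "(\<integral>\<^sup>+\<omega>. ennreal (Z N i y \<omega>) \<partial>M) = ennreal (expectation (Z N i y))"
      using Z_nonneg by (intro nn_integral_eq_integral) auto
    also have "expectation (Z N i y) = expectation (\<lambda>\<omega>. D N i y \<omega> ^ (2 * m)) / (2 ^ N * r ^ i) ^ (2 * m)"
      unfolding Z_def power_divide by (rule integral_divide_zero)
    also have "\<dots> = c * (expectation (\<lambda>\<omega>. (D N i y \<omega>)\<^sup>2) / (2 ^ N * r ^ i)\<^sup>2) ^ m"
      unfolding mom(2) by (simp only: power_mult power_divide times_divide_eq_right)
    also have "ennreal \<dots> \<le> ennreal (c * ((real ?n * 2 ^ N / 2 ^ i) powr (2 * H) / (2 ^ N * r ^ i)\<^sup>2) ^ m)"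
      by (intro ennreal_leI mult_left_mono power_mono divide_right_mono var c) auto
    also have "\<dots> = ennreal (c * (real ?n powr (2 * H)) ^ m * \<rho> ^ N * (q ^ m) ^ i)"
      unfolding pw \<rho>_def by (simp add: power_mult_distrib mult_ac flip: power_mult)
    finally show ?thesis .
  qed
  define S where "S \<omega> = (\<Sum>N. \<Sum>i. \<Sum>y\<in>int_box (2 ^ Suc i). ennreal (Z N i y \<omega>))" for \<omega>
  have [measurable]: "S \<in> borel_measurable M" unfolding S_def[abs_def] by measurable
  have "(\<integral>\<^sup>+\<omega>. S \<omega> \<partial>M) = (\<Sum>N. \<Sum>i. \<Sum>y\<in>int_box (2 ^ Suc i). \<integral>\<^sup>+\<omega>. ennreal (Z N i y \<omega>) \<partial>M)"
    unfolding S_def by (simp add: nn_integral_suminf nn_integral_sum)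
  also have "\<dots> \<le> (\<Sum>N. \<Sum>i. ennreal (K * \<rho> ^ N * \<theta> ^ i))"
  proof (intro suminf_le summableI allI)
    fix N i
    let ?e = "c * (real ?n powr (2 * H)) ^ m * \<rho> ^ N * (q ^ m) ^ i"
    have e0: "0 \<le> ?e" using c q \<rho> by simp
    have "(\<Sum>y\<in>(int_box (2 ^ Suc i) :: (int ^ 'n) set). \<integral>\<^sup>+\<omega>. ennreal (Z N i y \<omega>) \<partial>M) \<le>
        (\<Sum>y\<in>(int_box (2 ^ Suc i) :: (int ^ 'n) set). ennreal ?e)"
      by (intro sum_mono EZ)
    also have "\<dots> = ennreal (real (card (int_box (2 ^ Suc i) :: (int ^ 'n) set)) * ?e)"
      using e0 by (simp add: ennreal_mult ennreal_of_nat_eq_real_of_nat)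
    also have "\<dots> \<le> ennreal ((8 * 2 ^ i) ^ ?n * ?e)"
    proof (intro ennreal_leI mult_right_mono e0)
      have "real (card (int_box (2 ^ Suc i) :: (int ^ 'n) set)) \<le> (2 * real_of_int (2 ^ Suc i) + 1) ^ ?n"
        by (rule card_int_box) simp
      also have "\<dots> \<le> (8 * 2 ^ i) ^ ?n"
      proof (rule power_mono)
        have "1 \<le> (2 :: real) ^ i" by simp
        then show "2 * real_of_int (2 ^ Suc i) + 1 \<le> 8 * 2 ^ i"
          by (simp only: of_int_mult of_int_power of_int_numeral power_Suc)
      qed simp
      finally show "real (card (int_box (2 ^ Suc i) :: (int ^ 'n) set)) \<le> (8 * 2 ^ i) ^ ?n" .
    qed
    also have "(8 * 2 ^ i) ^ ?n * ?e = K * \<rho> ^ N * \<theta> ^ i"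
      unfolding K_def \<theta>_def by (simp add: power_mult_distrib mult_ac flip: power_mult)
    finally show "(\<Sum>y\<in>(int_box (2 ^ Suc i) :: (int ^ 'n) set). \<integral>\<^sup>+\<omega>. ennreal (Z N i y \<omega>) \<partial>M) \<le>
      ennreal (K * \<rho> ^ N * \<theta> ^ i)" .
  qed
  also have "\<dots> = (\<Sum>N. ennreal (K * \<rho> ^ N * (1 / (1 - \<theta>))))"
    by (intro suminf_cong suminf_ennreal_eq sums_mult geometric_sums) (use K \<rho> \<theta> in auto)
  also have "\<dots> = (\<Sum>N. ennreal (K / (1 - \<theta>) * \<rho> ^ N))"
    by (simp add: mult_ac)
  also have "\<dots> = ennreal (K / (1 - \<theta>) * (1 / (1 - \<rho>)))"
    by (intro suminf_ennreal_eq sums_mult geometric_sums) (use K \<rho> \<theta> in auto)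
  finally have "(\<integral>\<^sup>+\<omega>. S \<omega> \<partial>M) \<noteq> \<infinity>" by (auto simp: top_unique)
  then have "AE \<omega> in M. S \<omega> \<noteq> \<infinity>" by (intro nn_integral_PInf_AE) auto
  then show ?thesis
  proof (rule AE_mp, intro AE_I2 impI)
    fix \<omega> assume fin: "S \<omega> \<noteq> \<infinity>"
    define s where "s = enn2real (S \<omega>)"
    have s: "S \<omega> = ennreal s" using fin by (simp add: s_def less_top)
    have Zs: "Z N i y \<omega> \<le> s" if y: "y \<in> int_box (2 ^ Suc i)" for N i y
    proof -
      have "ennreal (Z N i y \<omega>) \<le> (\<Sum>y\<in>int_box (2 ^ Suc i). ennreal (Z N i y \<omega>))"
        by (rule member_le_sum[OF y]) (auto intro: finite_int_box)
      also have "\<dots> \<le> (\<Sum>i. \<Sum>y\<in>int_box (2 ^ Suc i). ennreal (Z N i y \<omega>))"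
        using sum_le_suminf[OF summableI, of "{i}" "\<lambda>i. \<Sum>y\<in>int_box (2 ^ Suc i). ennreal (Z N i y \<omega>)"] by simp
      also have "\<dots> \<le> S \<omega>"
        using sum_le_suminf[OF summableI, of "{N}" "\<lambda>N. \<Sum>i. \<Sum>y\<in>int_box (2 ^ Suc i). ennreal (Z N i y \<omega>)"]
        by (simp add: S_def)
      finally have "ennreal (Z N i y \<omega>) \<le> ennreal s" using s by simp
      moreover have "0 \<le> s" by (simp add: s_def)
      ultimately show ?thesis by (simp only: ennreal_le_iff)
    qed
    show "\<exists>C\<ge>0. \<forall>N i. \<forall>y\<in>int_box (2 ^ Suc i).
      \<bar>B (grid_point N (Suc i) y) \<omega> - B (grid_point N i (parent y)) \<omega>\<bar> \<le> C * 2 ^ N * r ^ i"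
    proof (intro exI[of _ "max 1 s"] conjI allI ballI)
      fix N i and y :: "int ^ 'n" assume y: "y \<in> int_box (2 ^ Suc i)"
      define x where "x = \<bar>D N i y \<omega>\<bar> / (2 ^ N * r ^ i)"
      have x0: "0 \<le> x" using r by (simp add: x_def)
      have Zx: "Z N i y \<omega> = x ^ (2 * m)"
        by (simp add: Z_def x_def power_divide power_even_abs)
      have "x \<le> max 1 s"
      \<comment> \<open>A power bounds its base only above 1, hence the constant \<open>max 1 s\<close>.\<close>
      proof (cases "x \<le> 1")
        case False
        then have "x ^ 1 \<le> x ^ (2 * m)" using m0 by (intro power_increasing) auto
        then show ?thesis using Zs[OF y, of N] Zx by simp
      qed simp
      then have "\<bar>D N i y \<omega>\<bar> \<le> max 1 s * (2 ^ N * r ^ i)"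
        using r by (simp add: x_def divide_le_eq)
      then show "\<bar>B (grid_point N (Suc i) y) \<omega> - B (grid_point N i (parent y)) \<omega>\<bar> \<le> max 1 s * 2 ^ N * r ^ i"
        by (simp add: D_def mult_ac)
    qed simp
  qed
qed

text \<open>
  Any growth of smaller order than the square of the norm would suffice for coercivity; exponent 1
  is a convenient choice above \<open>H\<close>.
\<close>

theorem fbf_linear_growth:
  fixes B :: "real ^ 'n \<Rightarrow> 'w \<Rightarrow> real"
  assumes "prob_space M" and H: "0 < H" "H < 1" and B: "fractional_brownian_field M H B"
  shows "AE \<omega> in M. \<exists>A\<ge>0. \<forall>t. \<bar>B t \<omega>\<bar> \<le> A * (1 + norm t)"
proof -
  have "AE \<omega> in M. continuous_on UNIV (\<lambda>t. B t \<omega>)" "AE \<omega> in M. B 0 \<omega> = 0"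
    using B by (auto simp: fractional_brownian_field_def)
  then show ?thesis
    using fbf_chain_bound[OF assms]
  proof eventually_elim
    case (elim \<omega>)
    then obtain C where C: "0 \<le> C" "\<forall>N i. \<forall>y\<in>int_box (2 ^ Suc i).
      \<bar>B (grid_point N (Suc i) y) \<omega> - B (grid_point N i (parent y)) \<omega>\<bar> \<le> C * 2 ^ N * (2 powr (- H / 2)) ^ i"
      by blast
    show ?case
    proof (rule linear_growth_of_chain_bound[OF elim(1,2) _ _ C(1)])
      show "0 < 2 powr (- H / 2)" "2 powr (- H / 2) < 1"
        using H by (auto simp: powr_less_one)
    qed (use C(2) in blast)
  qed
qed

section \<open>Existence of a minimiser\<close>

lemma edges_meeting_neighbour:
  assumes "lattice_adj u v" "u \<in> \<Lambda>"
  shows "{u, v} \<in> edges_meeting \<Lambda>"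
  using assms unfolding edges_meeting_def by auto

lemma edge_energy_nonneg:
  assumes "e \<in> edges_meeting \<Lambda>"
  shows "0 \<le> edge_energy \<phi> e"
  using assms by (auto simp: edges_meeting_def edge_energy_pair)

lemma continuous_edge_energy:
  assumes "e \<in> edges_meeting \<Lambda>"
  shows "continuous_on UNIV (\<lambda>\<phi> :: int ^ 'd \<Rightarrow> real ^ 'n. edge_energy \<phi> e)"
proof -
  obtain u v where e: "e = {u, v}"
    using assms by (auto simp: edges_meeting_def)
  have "continuous_on UNIV (\<lambda>\<phi> :: int ^ 'd \<Rightarrow> real ^ 'n. \<phi> w)" for w
    by (rule continuous_on_product_coordinates)
  then show ?thesis
    unfolding e edge_energy_pair by (intro continuous_intros)
qed

lemma continuous_hamiltonian:
  fixes \<eta> :: "int ^ 'd \<Rightarrow> real ^ 'n \<Rightarrow> real"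
  assumes "\<And>v. v \<in> \<Lambda> \<Longrightarrow> continuous_on UNIV (\<eta> v)"
  shows "continuous_on UNIV (hamiltonian \<eta> \<Lambda>)"
proof -
  have coord: "continuous_on UNIV (\<lambda>\<phi> :: int ^ 'd \<Rightarrow> real ^ 'n. \<phi> w)" for w
    by (rule continuous_on_product_coordinates)
  have "continuous_on UNIV (\<lambda>\<phi> :: int ^ 'd \<Rightarrow> real ^ 'n. \<eta> v (\<phi> v))" if "v \<in> \<Lambda>" for v
    by (rule continuous_on_compose2[OF assms[OF that] coord]) simp
  then show ?thesis
    unfolding hamiltonian_def[abs_def]
    by (intro continuous_intros continuous_edge_energy) auto
qed

definition dirichlet_energy :: "(int ^ 'd) set \<Rightarrow> (int ^ 'd \<Rightarrow> real ^ 'n) \<Rightarrow> real" where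
  "dirichlet_energy \<Lambda> \<phi> = (\<Sum>e\<in>edges_meeting \<Lambda>. edge_energy \<phi> e)"

lemma dirichlet_energy_nonneg: "0 \<le> dirichlet_energy \<Lambda> \<phi>"
  unfolding dirichlet_energy_def by (intro sum_nonneg edge_energy_nonneg)

lemma norm_diff_le_sqrt_dirichlet_energy:
  assumes "finite \<Lambda>" "lattice_adj u v" "u \<in> \<Lambda>"
  shows "norm (\<phi> u - \<phi> v) \<le> sqrt (dirichlet_energy \<Lambda> \<phi>)"
proof (rule real_le_rsqrt)
  have "(norm (\<phi> u - \<phi> v))\<^sup>2 = edge_energy \<phi> {u, v}"
    by (simp add: edge_energy_pair)
  also have "\<dots> \<le> dirichlet_energy \<Lambda> \<phi>"
    unfolding dirichlet_energy_def
    by (intro member_le_sum edges_meeting_neighbour assms finite_edges_meeting)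
      (auto intro: edge_energy_nonneg)
  finally show "(norm (\<phi> u - \<phi> v))\<^sup>2 \<le> dirichlet_energy \<Lambda> \<phi>" .
qed

lemma lattice_adj_step: "lattice_adj v (v + axis k 1)"
  unfolding lattice_adj_def
  by (simp add: axis_def if_distrib cong: if_cong)

text \<open>
  Induction along the walk \<open>v\<close>, \<open>v + e\<^sub>k\<close>, \<open>v + 2 e\<^sub>k\<close>, ...: each step inside \<open>\<Lambda>\<close> costs at most
  the square root of the total energy, and outside \<open>\<Lambda>\<close> the spin is given by \<open>\<tau>\<close>.
\<close>

lemma spin_bound_by_steps:
  fixes \<tau> :: "int ^ 'd \<Rightarrow> real ^ 'n"
  assumes "finite \<Lambda>" and "v + of_nat m *s axis k 1 \<notin> \<Lambda>"
  shows "\<exists>A\<ge>0. \<forall>\<phi>\<in>configurations \<Lambda> \<tau>. norm (\<phi> v) \<le> A * (1 + sqrt (dirichlet_energy \<Lambda> \<phi>))"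
  using assms(2)
proof (induction m arbitrary: v)
  case 0
  then have "v \<notin> \<Lambda>" by simp
  then show ?case
    by (intro exI[of _ "norm (\<tau> v)"])
      (auto simp: configurations_def distrib_left dirichlet_energy_nonneg)
next
  case (Suc m)
  show ?case
  proof (cases "v \<in> \<Lambda>")
    case False
    then show ?thesis
      by (intro exI[of _ "norm (\<tau> v)"])
        (auto simp: configurations_def distrib_left dirichlet_energy_nonneg)
  next
    case True
    have "(v + axis k 1) + of_nat m *s axis k 1 \<notin> \<Lambda>"
      using Suc.prems by (simp add: vector_sadd_rdistrib add.assoc)
    then obtain A where A: "A \<ge> 0" "\<And>\<phi>. \<phi> \<in> configurations \<Lambda> \<tau> \<Longrightarrow>
        norm (\<phi> (v + axis k 1)) \<le> A * (1 + sqrt (dirichlet_energy \<Lambda> \<phi>))"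
      using Suc.IH by blast
    have "norm (\<phi> v) \<le> (A + 1) * (1 + sqrt (dirichlet_energy \<Lambda> \<phi>))" if "\<phi> \<in> configurations \<Lambda> \<tau>" for \<phi>
    proof -
      have "norm (\<phi> v) \<le> norm (\<phi> (v + axis k 1)) + norm (\<phi> v - \<phi> (v + axis k 1))"
        using norm_triangle_sub by blast
      also have "\<dots> \<le> A * (1 + sqrt (dirichlet_energy \<Lambda> \<phi>)) + sqrt (dirichlet_energy \<Lambda> \<phi>)"
        by (intro add_mono A(2)[OF that] norm_diff_le_sqrt_dirichlet_energy assms(1)
            lattice_adj_step True)
      also have "\<dots> \<le> (A + 1) * (1 + sqrt (dirichlet_energy \<Lambda> \<phi>))"
        by (simp add: algebra_simps)
      finally show ?thesis .
    qed
    then show ?thesis using A(1) by (intro exI[of _ "A + 1"]) auto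
  qed
qed

lemma exists_step_outside:
  fixes v :: "int ^ 'd"
  assumes "finite \<Lambda>"
  shows "\<exists>m :: nat. v + of_nat m *s axis k 1 \<notin> \<Lambda>"
proof (rule ccontr)
  assume "\<not> ?thesis"
  then have "range (\<lambda>m :: nat. v + of_nat m *s axis k 1) \<subseteq> \<Lambda>" by auto
  then have "finite (range (\<lambda>m :: nat. v + of_nat m *s axis k 1))"
    using assms by (rule finite_subset)
  moreover have "inj (\<lambda>m :: nat. v + of_nat m *s axis k 1)"
    by (rule injI) (auto simp: vec_eq_iff axis_def dest!: spec[of _ k])
  ultimately show False
    using finite_imageD infinite_UNIV_nat by blast
qed

lemma discrete_poincare:
  fixes \<tau> :: "int ^ 'd \<Rightarrow> real ^ 'n"
  assumes "finite \<Lambda>"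
  shows "\<exists>A\<ge>0. \<forall>\<phi>\<in>configurations \<Lambda> \<tau>. \<forall>v\<in>\<Lambda>. norm (\<phi> v) \<le> A * (1 + sqrt (dirichlet_energy \<Lambda> \<phi>))"
proof -
  have "\<exists>A\<ge>0. \<forall>\<phi>\<in>configurations \<Lambda> \<tau>. norm (\<phi> v) \<le> A * (1 + sqrt (dirichlet_energy \<Lambda> \<phi>))" for v
    using spin_bound_by_steps[OF assms] exists_step_outside[OF assms] by blast
  then obtain a where a0: "\<And>v. a v \<ge> 0"
    and a: "\<And>v \<phi>. \<phi> \<in> configurations \<Lambda> \<tau> \<Longrightarrow> norm (\<phi> v) \<le> a v * (1 + sqrt (dirichlet_energy \<Lambda> \<phi>))"
    by metis
  have "norm (\<phi> v) \<le> (\<Sum>v\<in>\<Lambda>. a v) * (1 + sqrt (dirichlet_energy \<Lambda> \<phi>))"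
    if "\<phi> \<in> configurations \<Lambda> \<tau>" "v \<in> \<Lambda>" for \<phi> v
  proof -
    have "a v \<le> (\<Sum>v\<in>\<Lambda>. a v)"
      by (intro member_le_sum assms that(2)) (simp add: a0)
    then have "a v * (1 + sqrt (dirichlet_energy \<Lambda> \<phi>)) \<le> (\<Sum>v\<in>\<Lambda>. a v) * (1 + sqrt (dirichlet_energy \<Lambda> \<phi>))"
      by (intro mult_right_mono) (simp_all add: dirichlet_energy_nonneg)
    then show ?thesis using a[OF that(1), of v] by linarith
  qed
  then show ?thesis
    by (intro exI[of _ "\<Sum>v\<in>\<Lambda>. a v"]) (auto intro: sum_nonneg a0)
qed

text \<open>
  With \<open>s\<close> the square root of the Dirichlet energy, the bound \<open>hamiltonian \<eta> \<Lambda> \<phi> \<le> h\<close> becomes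
  \<open>s\<^sup>2 / 2 - K * (1 + s) \<le> h\<close>, which bounds \<open>s\<close> and hence all spins.
\<close>

lemma hamiltonian_coercive:
  fixes \<eta> :: "int ^ 'd \<Rightarrow> real ^ 'n \<Rightarrow> real"
  assumes "finite \<Lambda>"
    and growth: "\<And>v. v \<in> \<Lambda> \<Longrightarrow> \<exists>A\<ge>0. \<forall>t. \<bar>\<eta> v t\<bar> \<le> A * (1 + norm t)"
  shows "\<exists>R. \<forall>\<phi>\<in>configurations \<Lambda> \<tau>. hamiltonian \<eta> \<Lambda> \<phi> \<le> h \<longrightarrow> (\<forall>v\<in>\<Lambda>. norm (\<phi> v) \<le> R)"
proof -
  obtain A where A0: "A \<ge> 0" and A: "\<And>\<phi> v. \<phi> \<in> configurations \<Lambda> \<tau> \<Longrightarrow> v \<in> \<Lambda> \<Longrightarrow>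
      norm (\<phi> v) \<le> A * (1 + sqrt (dirichlet_energy \<Lambda> \<phi>))"
    using discrete_poincare[OF assms(1), of \<tau>] by blast
  obtain b where b0: "\<And>v. v \<in> \<Lambda> \<Longrightarrow> b v \<ge> 0"
    and b: "\<And>v t. v \<in> \<Lambda> \<Longrightarrow> \<bar>\<eta> v t\<bar> \<le> b v * (1 + norm t)"
    using growth by metis
  define K where "K = (\<Sum>v\<in>\<Lambda>. b v) * (1 + A)"
  have K0: "0 \<le> K" unfolding K_def using A0 by (intro mult_nonneg_nonneg sum_nonneg b0) auto
  have bound: "norm (\<phi> v) \<le> A * (1 + (2 * K + 2 * \<bar>h\<bar> + 2))"
    if \<phi>: "\<phi> \<in> configurations \<Lambda> \<tau>" and h: "hamiltonian \<eta> \<Lambda> \<phi> \<le> h" and v: "v \<in> \<Lambda>" for \<phi> v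
  proof -
    define s where "s = sqrt (dirichlet_energy \<Lambda> \<phi>)"
    have s0: "0 \<le> s" and s2: "s\<^sup>2 = dirichlet_energy \<Lambda> \<phi>"
      by (simp_all add: s_def dirichlet_energy_nonneg)
    have "- (b w * ((1 + A) * (1 + s))) \<le> \<eta> w (\<phi> w)" if w: "w \<in> \<Lambda>" for w
    proof -
      have "1 + norm (\<phi> w) \<le> (1 + A) * (1 + s)"
        using A[OF \<phi> w, folded s_def] s0 by (simp add: algebra_simps)
      then have "b w * (1 + norm (\<phi> w)) \<le> b w * ((1 + A) * (1 + s))"
        by (intro mult_left_mono b0 w)
      then show ?thesis using b[OF w, of "\<phi> w"] by linarith
    qed
    then have "(\<Sum>w\<in>\<Lambda>. - (b w * ((1 + A) * (1 + s)))) \<le> (\<Sum>w\<in>\<Lambda>. \<eta> w (\<phi> w))"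
      by (rule sum_mono)
    also have "(\<Sum>w\<in>\<Lambda>. - (b w * ((1 + A) * (1 + s)))) = - (K * (1 + s))"
      by (simp add: K_def sum_negf sum_distrib_right mult.assoc)
    finally have "s\<^sup>2 / 2 - K * (1 + s) \<le> h"
      using h by (simp add: hamiltonian_def s2 flip: dirichlet_energy_def)
    then have quad: "s\<^sup>2 \<le> 2 * K * s + (2 * K + 2 * \<bar>h\<bar>)" by (simp add: algebra_simps)
    have "s \<le> 2 * K + 2 * \<bar>h\<bar> + 2"
    proof (rule ccontr)
      assume "\<not> ?thesis"
      then have s: "2 * K + 2 * \<bar>h\<bar> + 2 < s" by simp
      then have "(2 * K + 2 * \<bar>h\<bar> + 2) * s \<le> s * s"
        using s0 by (intro mult_right_mono) auto
      then have "(2 * \<bar>h\<bar> + 2) * s \<le> 2 * K + 2 * \<bar>h\<bar>"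
        using quad by (simp add: power2_eq_square algebra_simps)
      moreover have "1 * s \<le> (2 * \<bar>h\<bar> + 2) * s"
        using s0 by (intro mult_right_mono) auto
      ultimately show False using s by simp
    qed
    then have "A * (1 + s) \<le> A * (1 + (2 * K + 2 * \<bar>h\<bar> + 2))"
      using A0 by (intro mult_left_mono) auto
    then show ?thesis using A[OF \<phi> v] by (simp add: s_def)
  qed
  then show ?thesis by blast
qed

text \<open>
  In the product topology the configurations with spins in a fixed ball form a compact set, by
  Tychonoff's theorem, and the Hamiltonian is continuous.
\<close>

theorem hamiltonian_minimiser_exists:
  fixes \<eta> :: "int ^ 'd \<Rightarrow> real ^ 'n \<Rightarrow> real"
  assumes fin: "finite \<Lambda>"
    and cont: "\<And>v. v \<in> \<Lambda> \<Longrightarrow> continuous_on UNIV (\<eta> v)"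
    and growth: "\<And>v. v \<in> \<Lambda> \<Longrightarrow> \<exists>A\<ge>0. \<forall>t. \<bar>\<eta> v t\<bar> \<le> A * (1 + norm t)"
  shows "\<exists>\<phi>. is_arg_min (hamiltonian \<eta> \<Lambda>) (\<lambda>\<psi>. \<psi> \<in> configurations \<Lambda> \<tau>) \<phi>"
proof -
  have coercive: "\<exists>R. \<forall>\<phi>\<in>configurations \<Lambda> \<tau>. hamiltonian \<eta> \<Lambda> \<phi> \<le> hamiltonian \<eta> \<Lambda> \<tau> \<longrightarrow>
      (\<forall>v\<in>\<Lambda>. norm (\<phi> v) \<le> R)"
    by (rule hamiltonian_coercive[OF fin growth])
  obtain R where R: "\<And>\<phi> v. \<phi> \<in> configurations \<Lambda> \<tau> \<Longrightarrow>
      hamiltonian \<eta> \<Lambda> \<phi> \<le> hamiltonian \<eta> \<Lambda> \<tau> \<Longrightarrow> v \<in> \<Lambda> \<Longrightarrow> norm (\<phi> v) \<le> R"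
    using coercive by blast
  \<comment> \<open>A minimiser is at most as costly as \<open>\<tau>\<close>, so this compact box contains all candidates.\<close>
  define S where "S v = (if v \<in> \<Lambda> then cball 0 R else {\<tau> v})" for v
  have \<tau>: "\<tau> \<in> configurations \<Lambda> \<tau>" by (simp add: configurations_def)
  have "compactin (product_topology (\<lambda>_. euclidean) UNIV) (PiE UNIV S)"
    unfolding compactin_PiE by (auto simp: S_def)
  then have "compact (PiE UNIV S)"
    unfolding euclidean_product_topology compactin_euclidean_iff .
  moreover have \<tau>_S: "\<tau> \<in> PiE UNIV S"
    using R[OF \<tau>] by (auto simp: S_def)
  moreover have "continuous_on (PiE UNIV S) (hamiltonian \<eta> \<Lambda>)"
    by (rule continuous_on_subset[OF continuous_hamiltonian[OF cont]]) auto
  ultimately have "\<exists>\<phi>\<in>PiE UNIV S. \<forall>\<psi>\<in>PiE UNIV S. hamiltonian \<eta> \<Lambda> \<phi> \<le> hamiltonian \<eta> \<Lambda> \<psi>"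
    by (intro continuous_attains_inf) auto
  then obtain \<phi> where \<phi>: "\<phi> \<in> PiE UNIV S"
    and min: "\<And>\<psi>. \<psi> \<in> PiE UNIV S \<Longrightarrow> hamiltonian \<eta> \<Lambda> \<phi> \<le> hamiltonian \<eta> \<Lambda> \<psi>"
    by auto
  have "\<phi> v = \<tau> v" if "v \<notin> \<Lambda>" for v
    using \<phi> that by (auto simp: S_def PiE_iff split: if_splits dest!: spec[of _ v])
  then have conf: "\<phi> \<in> configurations \<Lambda> \<tau>" by (simp add: configurations_def)
  have "hamiltonian \<eta> \<Lambda> \<phi> \<le> hamiltonian \<eta> \<Lambda> \<psi>" if \<psi>: "\<psi> \<in> configurations \<Lambda> \<tau>" for \<psi>
  proof (cases "hamiltonian \<eta> \<Lambda> \<psi> \<le> hamiltonian \<eta> \<Lambda> \<tau>")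
    case True
    then have "\<psi> \<in> PiE UNIV S"
      using R[OF \<psi>] \<psi> by (auto simp: S_def configurations_def)
    then show ?thesis by (rule min)
  next
    case False
    then show ?thesis using min[OF \<tau>_S] by simp
  qed
  then have "is_arg_min (hamiltonian \<eta> \<Lambda>) (\<lambda>\<psi>. \<psi> \<in> configurations \<Lambda> \<tau>) \<phi>"
    using conf by (auto simp: is_arg_min_def not_less)
  then show ?thesis by (rule exI[where x = \<phi>])
qed

section \<open>Splitting off one Gaussian coordinate of the disorder\<close>

lemma (in prob_space) centered_gaussian_no_atoms:
  assumes X: "gaussian_variable M X" "expectation X = 0"
    and var: "expectation (\<lambda>\<omega>. (X \<omega>)\<^sup>2) \<noteq> 0"
  shows "AE x in distr M borel X. x \<noteq> c"
  using X
proof (cases rule: centered_gaussian_cases)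
  case 1
  have [measurable]: "X \<in> borel_measurable M"
    using X by (simp add: gaussian_variable_def)
  have "expectation (\<lambda>\<omega>. (X \<omega>)\<^sup>2) = (LINT \<omega>|M. 0)"
    using 1 by (intro integral_cong_AE) auto
  with var show ?thesis by simp
next
  case (2 \<sigma>)
  have [measurable]: "X \<in> borel_measurable M"
    using X by (simp add: gaussian_variable_def)
  have "distr M lborel X = density lborel (normal_density 0 \<sigma>)"
    using 2 by (simp add: distributed_def)
  moreover have "AE x in density lborel (normal_density 0 \<sigma>). x \<noteq> c"
    by (subst AE_density) (auto intro: AE_mp[OF AE_lborel_singleton[of c]])
  ultimately have "AE x in distr M lborel X. x \<noteq> c" by (simp only:)
  then have "AE \<omega> in M. X \<omega> \<noteq> c"
    by (subst (asm) AE_distr_iff) auto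
  then show ?thesis
    by (subst AE_distr_iff) auto
qed

text \<open>
  Up to an additive constant and the factor 2, this is the covariance of \<open>B\<^sub>t\<close> with \<open>B\<^sub>p - B\<^sub>q\<close>.
  Its sign tells on which side of the perpendicular bisector of \<open>p\<close> and \<open>q\<close> the point \<open>t\<close> lies.
\<close>

definition bisector_contrast :: "real \<Rightarrow> real ^ 'n \<Rightarrow> real ^ 'n \<Rightarrow> real ^ 'n \<Rightarrow> real" where
  "bisector_contrast H p q t = norm (t - q) powr (2 * H) - norm (t - p) powr (2 * H)"

lemma continuous_bisector_contrast:
  assumes "0 < H"
  shows "continuous_on UNIV (bisector_contrast H p q)"
  unfolding bisector_contrast_def[abs_def] using assms
  by (intro continuous_intros continuous_on_powr') auto

text \<open>
  Take \<open>p\<close> within a quarter of the distance from \<open>s\<close>, and \<open>q\<close> likewise near \<open>t\<close>.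
\<close>

lemma bisector_contrast_separates:
  assumes H: "0 < H" and neq: "s \<noteq> t"
    and dense: "\<And>X :: (real ^ 'n) set. open X \<Longrightarrow> X \<noteq> {} \<Longrightarrow> \<exists>q\<in>Q. q \<in> X"
  obtains p q where "p \<in> Q" "q \<in> Q" "p \<noteq> q"
    "bisector_contrast H p q s > 0" "bisector_contrast H p q t < 0"
proof -
  define r where "r = dist s t / 4"
  have r: "r > 0" using neq by (simp add: r_def)
  obtain p where p: "p \<in> Q" "dist s p < r"
    using dense[of "ball s r"] r by (auto simp: dist_commute)
  obtain q where q: "q \<in> Q" "dist t q < r"
    using dense[of "ball t r"] r by (auto simp: dist_commute)
  have rst: "dist s t = 4 * r" by (simp add: r_def)
  have "dist s t \<le> dist s q + dist t q" "dist s t \<le> dist s p + dist t p"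
    by (rule dist_triangle2)+
  with p q r rst have sq: "dist s p < dist s q" and tp: "dist t q < dist t p"
    by - linarith+
  then have "p \<noteq> q" by auto
  moreover have "bisector_contrast H p q s > 0" "bisector_contrast H p q t < 0"
    using powr_less_mono2[of "2 * H" "norm (s - p)" "norm (s - q)"]
      powr_less_mono2[of "2 * H" "norm (t - q)" "norm (t - p)"] H sq tp
    by (simp_all add: bisector_contrast_def dist_norm)
  ultimately show thesis using that p q by blast
qed

text \<open>
  Polarisation: \<open>2 * (b - c) * a = (a - c)\<^sup>2 - (a - b)\<^sup>2 + b\<^sup>2 - c\<^sup>2\<close>. The constant \<open>\<kappa>\<close> collects the
  terms without \<open>t\<close>; it does not affect comparisons between different \<open>t\<close>.
\<close>

lemma fbf_covariance_increment:
  assumes M: "prob_space M" and B: "fractional_brownian_field M H B"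
  obtains \<kappa> where "\<And>t. (LINT \<omega>|M. (B p \<omega> - B q \<omega>) * B t \<omega>) = (bisector_contrast H p q t + \<kappa>) / 2"
proof -
  interpret centered_gaussian_process M B
    using M B by (rule fbf_centered_gaussian)
  note base = linear_combinations_base[of B]
  have inc: "(B s \<omega> - B t \<omega>) * (B s \<omega> - B t \<omega>) = (B s \<omega> - B t \<omega>)\<^sup>2" for s t \<omega>
    by (simp add: power2_eq_square)
  have int: "integrable M (\<lambda>\<omega>. (B s \<omega> - B t \<omega>)\<^sup>2)" for s t
    using integrable_combination_mult[OF linear_combinations_diff[OF base base]
        linear_combinations_diff[OF base base], of s t s t]
    by (simp only: inc)
  have intsq: "integrable M (\<lambda>\<omega>. B s \<omega> * B s \<omega>)" for s
    by (rule integrable_combination_mult[OF base base])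
  define \<kappa> where "\<kappa> = expectation (\<lambda>\<omega>. B p \<omega> * B p \<omega>) - expectation (\<lambda>\<omega>. B q \<omega> * B q \<omega>)"
  have "(LINT \<omega>|M. (B p \<omega> - B q \<omega>) * B t \<omega>) = (bisector_contrast H p q t + \<kappa>) / 2" for t
  proof -
    have "(LINT \<omega>|M. (B p \<omega> - B q \<omega>) * B t \<omega>) =
      (LINT \<omega>|M. (((B t \<omega> - B q \<omega>)\<^sup>2 - (B t \<omega> - B p \<omega>)\<^sup>2) + (B p \<omega> * B p \<omega> - B q \<omega> * B q \<omega>)) / 2)"
      by (rule Bochner_Integration.integral_cong) (auto simp: power2_eq_square algebra_simps)
    also have "\<dots> = ((LINT \<omega>|M. (B t \<omega> - B q \<omega>)\<^sup>2) - (LINT \<omega>|M. (B t \<omega> - B p \<omega>)\<^sup>2) + \<kappa>) / 2"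
      by (simp only: integral_divide_zero Bochner_Integration.integral_add
          Bochner_Integration.integral_diff Bochner_Integration.integrable_diff int intsq \<kappa>_def)
    finally show ?thesis
      by (simp only: fbf_increment_second_moment[OF M B] bisector_contrast_def)
  qed
  then show thesis by (rule that)
qed

text \<open>
  The hypothesis on \<open>g\<close> makes the residual \<open>Y (v, t)\<close> uncorrelated with \<open>\<xi>\<close>. A finite linear
  combination of residuals splits into independent contributions of the vertices, and only the
  one at \<open>v\<close> interacts with \<open>\<xi>\<close>. There the process is Gaussian, so the characteristic function
  factorises, as Kac's theorem requires.
\<close>

lemma (in prob_space) fbf_disorder_decoupling:
  fixes \<eta> :: "int ^ 'd \<Rightarrow> real ^ 'n \<Rightarrow> 'a \<Rightarrow> real" and g :: "real ^ 'n \<Rightarrow> real"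
    and v :: "int ^ 'd" and p q :: "real ^ 'n"
  assumes dis: "fbf_disorder M H \<eta>"
  defines "\<xi> \<equiv> \<lambda>\<omega>. \<eta> v p \<omega> - \<eta> v q \<omega>"
  assumes g: "\<And>t. expectation (\<lambda>\<omega>. \<xi> \<omega> * \<eta> v t \<omega>) = g t * expectation (\<lambda>\<omega>. \<xi> \<omega> * \<xi> \<omega>)"
  defines "Y \<equiv> \<lambda>(w, t) \<omega>. \<eta> w t \<omega> - (if w = v then g t * \<xi> \<omega> else 0)"
  shows "distr M borel \<xi> \<Otimes>\<^sub>M distr M (Pi\<^sub>M UNIV (\<lambda>_. borel)) (\<lambda>\<omega> i. Y i \<omega>) =
    distr M (borel \<Otimes>\<^sub>M Pi\<^sub>M UNIV (\<lambda>_. borel)) (\<lambda>\<omega>. (\<xi> \<omega>, \<lambda>i. Y i \<omega>))"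
proof (rule kac_independence)
  have fbf: "fractional_brownian_field M H (\<eta> w)" for w
    using dis by (simp add: fbf_disorder_def)
  interpret V: centered_gaussian_process M "\<eta> v"
    by (rule fbf_centered_gaussian[OF prob_space_axioms fbf])
  have m\<eta> [measurable]: "\<eta> w t \<in> borel_measurable M" for w t
  proof -
    interpret W: centered_gaussian_process M "\<eta> w"
      by (rule fbf_centered_gaussian[OF prob_space_axioms fbf])
    show ?thesis by (rule W.measurable_combination[OF linear_combinations_base])
  qed
  show m\<xi> [measurable]: "\<xi> \<in> borel_measurable M"
    unfolding \<xi>_def by measurable
  show "Y i \<in> borel_measurable M" for i
    unfolding Y_def by (cases i; cases "fst i = v") auto
  have \<xi>: "\<xi> \<in> linear_combinations (\<eta> v)"
    unfolding \<xi>_def by (intro linear_combinations_diff linear_combinations_base)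
  have Yv: "Y (v, t) \<in> linear_combinations (\<eta> v)" for t
    unfolding Y_def using \<xi>
    by (auto intro!: linear_combinations_diff linear_combinations_base linear_combinations_scale)
  have orth: "expectation (\<lambda>\<omega>. \<xi> \<omega> * Y (v, t) \<omega>) = 0" for t
  proof -
    have "expectation (\<lambda>\<omega>. \<xi> \<omega> * Y (v, t) \<omega>) =
        expectation (\<lambda>\<omega>. \<xi> \<omega> * \<eta> v t \<omega> - g t * (\<xi> \<omega> * \<xi> \<omega>))"
      by (rule Bochner_Integration.integral_cong) (auto simp: Y_def algebra_simps)
    also have "\<dots> = expectation (\<lambda>\<omega>. \<xi> \<omega> * \<eta> v t \<omega>) - g t * expectation (\<lambda>\<omega>. \<xi> \<omega> * \<xi> \<omega>)"
      by (simp only: Bochner_Integration.integral_diff integrable_mult_right integral_mult_right_zero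
          V.integrable_combination_mult[OF \<xi> linear_combinations_base]
          V.integrable_combination_mult[OF \<xi> \<xi>])
    finally show ?thesis using g by simp
  qed
  fix J :: "((int ^ 'd) \<times> (real ^ 'n)) set" and a :: real and b
  assume J: "finite J"
  define W where "W = insert v (fst ` J)"
  have W: "finite W" "v \<in> W" using J by (auto simp: W_def)
  define U where "U w \<omega> = (\<Sum>j | j \<in> J \<and> fst j = w. b j * Y j \<omega>)" for w \<omega>
  have U_sum: "(\<Sum>j\<in>J. b j * Y j \<omega>) = (\<Sum>w\<in>W. U w \<omega>)" for \<omega>
    unfolding U_def using J W by (intro sum.group[symmetric]) (auto simp: W_def)
  define F where "F c w x =
      (\<Sum>j | j \<in> J \<and> fst j = w. b j * (x (snd j) - (if w = v then g (snd j) * (x p - x q) else 0))) +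
      (if w = v then c * (x p - x q) else 0)" for c :: real and w and x :: "real ^ 'n \<Rightarrow> real"
  have F\<eta>: "F c w (\<lambda>t. \<eta> w t \<omega>) = U w \<omega> + (if w = v then c * \<xi> \<omega> else 0)" for c w \<omega>
    unfolding F_def U_def Y_def \<xi>_def by (auto intro!: sum.cong simp: case_prod_beta)
  have mF: "F c w \<in> borel_measurable (Pi\<^sub>M UNIV (\<lambda>_. borel))" for c w
    unfolding F_def[abs_def] by (cases "w = v") simp_all
  have indep: "indep_vars (\<lambda>_. borel) (\<lambda>w \<omega>. F c w (\<lambda>t. \<eta> w t \<omega>)) W" for c
    using dis mF unfolding fbf_disorder_def
    by (intro indep_vars_compose2[where M' = "\<lambda>_. Pi\<^sub>M UNIV (\<lambda>_. borel)" and X = "\<lambda>w \<omega> t. \<eta> w t \<omega>" and Y = "F c"])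
      (auto intro: indep_vars_subset)
  have mFc: "(\<lambda>\<omega>. F c w (\<lambda>t. \<eta> w t \<omega>)) \<in> borel_measurable M" if "w \<in> W" for c w
    using indep[of c] that by (simp add: indep_vars_def)
  have char_iexp: "char (distr M borel X) 1 = (CLINT \<omega>|M. iexp (X \<omega>))" if "X \<in> borel_measurable M" for X
    using that by (simp add: char_def integral_distr)
  have prod: "(CLINT \<omega>|M. iexp (\<Sum>w\<in>W. F c w (\<lambda>t. \<eta> w t \<omega>))) =
      (\<Prod>w\<in>W. CLINT \<omega>|M. iexp (F c w (\<lambda>t. \<eta> w t \<omega>)))" for c
    using char_distr_sum[OF indep[of c], of 1] char_iexp[OF mFc] char_iexp[OF borel_measurable_sum[OF mFc], of W id]
    by simp
  have F_sum: "(\<Sum>w\<in>W. F c w (\<lambda>t. \<eta> w t \<omega>)) = c * \<xi> \<omega> + (\<Sum>j\<in>J. b j * Y j \<omega>)" for c \<omega>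
    unfolding F\<eta> U_sum sum.distrib using W by (simp add: sum.delta)
  have split: "(CLINT \<omega>|M. iexp (c * \<xi> \<omega> + (\<Sum>j\<in>J. b j * Y j \<omega>))) =
      (CLINT \<omega>|M. iexp (c * \<xi> \<omega> + U v \<omega>)) * (\<Prod>w\<in>W - {v}. CLINT \<omega>|M. iexp (U w \<omega>))" for c
  proof -
    have Fv: "F c v (\<lambda>t. \<eta> v t \<omega>) = c * \<xi> \<omega> + U v \<omega>" for \<omega>
      unfolding F\<eta> by simp
    have "(CLINT \<omega>|M. iexp (c * \<xi> \<omega> + (\<Sum>j\<in>J. b j * Y j \<omega>))) =
        (CLINT \<omega>|M. iexp (F c v (\<lambda>t. \<eta> v t \<omega>))) * (\<Prod>w\<in>W - {v}. CLINT \<omega>|M. iexp (F c w (\<lambda>t. \<eta> w t \<omega>)))"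
      unfolding F_sum[symmetric] prod by (rule prod.remove[OF W])
    also have "(\<Prod>w\<in>W - {v}. CLINT \<omega>|M. iexp (F c w (\<lambda>t. \<eta> w t \<omega>))) =
        (\<Prod>w\<in>W - {v}. CLINT \<omega>|M. iexp (U w \<omega>))"
      unfolding F\<eta> by (rule prod.cong) auto
    finally show ?thesis unfolding Fv .
  qed
  have Uv: "U v \<in> linear_combinations (\<eta> v)"
    unfolding U_def[abs_def]
    by (intro linear_combinations_sum linear_combinations_scale) (auto intro: Yv)
  have Uv_orth: "expectation (\<lambda>\<omega>. \<xi> \<omega> * U v \<omega>) = 0"
  proof -
    have intj: "integrable M (\<lambda>\<omega>. \<xi> \<omega> * Y j \<omega>)" if "fst j = v" for j
      using V.integrable_combination_mult[OF \<xi> Yv, of "snd j"] that by (cases j) simp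
    have orthj: "expectation (\<lambda>\<omega>. \<xi> \<omega> * Y j \<omega>) = 0" if "fst j = v" for j
      using orth[of "snd j"] that by (cases j) simp
    have "expectation (\<lambda>\<omega>. \<xi> \<omega> * U v \<omega>) =
        expectation (\<lambda>\<omega>. \<Sum>j | j \<in> J \<and> fst j = v. b j * (\<xi> \<omega> * Y j \<omega>))"
      unfolding U_def by (simp add: sum_distrib_left mult.left_commute)
    also have "\<dots> = (\<Sum>j | j \<in> J \<and> fst j = v. expectation (\<lambda>\<omega>. b j * (\<xi> \<omega> * Y j \<omega>)))"
      by (rule Bochner_Integration.integral_sum) (auto intro!: integrable_mult_right intj)
    also have "\<dots> = 0"
      by (rule sum.neutral) (auto simp: orthj)
    finally show ?thesis .
  qed
  have "(CLINT \<omega>|M. iexp (a * \<xi> \<omega> + U v \<omega>)) = (CLINT \<omega>|M. iexp (a * \<xi> \<omega>)) * (CLINT \<omega>|M. iexp (U v \<omega>))"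
    by (rule V.char_uncorrelated[OF \<xi> Uv Uv_orth])
  then show "(CLINT \<omega>|M. iexp (a * \<xi> \<omega> + (\<Sum>j\<in>J. b j * Y j \<omega>))) =
      (CLINT \<omega>|M. iexp (a * \<xi> \<omega>)) * (CLINT \<omega>|M. iexp (\<Sum>j\<in>J. b j * Y j \<omega>))"
    using split[of a] split[of 0] by simp
qed

section \<open>Uniqueness of the minimiser\<close>

text \<open>
  At every precision, near-minimisers of \<open>F\<close> along the sequence \<open>e\<close> occur both where \<open>h\<close> is above
  \<open>\<delta>\<close> and where it is below \<open>- \<delta>\<close>. A countable sequence stands in for the whole space, which
  makes this a measurable condition when \<open>F\<close> is random.
\<close>

definition two_sided_near_minimal ::
    "('c \<Rightarrow> real) \<Rightarrow> ('c \<Rightarrow> real) \<Rightarrow> (nat \<Rightarrow> 'c) \<Rightarrow> real \<Rightarrow> bool" where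
  "two_sided_near_minimal F h e \<delta> \<longleftrightarrow> (\<forall>k.
     (\<exists>i. h (e i) > \<delta> \<and> (\<forall>j. F (e i) \<le> F (e j) + 1 / real (Suc k))) \<and>
     (\<exists>i. h (e i) < - \<delta> \<and> (\<forall>j. F (e i) \<le> F (e j) + 1 / real (Suc k))))"

text \<open>
  For \<open>x < y\<close>, compare a near-minimiser at parameter \<open>x\<close> on the low side with one at
  parameter \<open>y\<close> on the high side. Adding the two near-minimality inequalities cancels \<open>G\<close> and
  leaves \<open>(y - x) * (g (e j) - g (e i)) \<le> 2 / (k + 1)\<close>, whose left side is bounded below
  independently of \<open>k\<close>.
\<close>

lemma two_sided_near_minimal_tilt_unique:
  assumes x: "two_sided_near_minimal (\<lambda>\<phi>. G \<phi> + x * g \<phi>) h e \<delta>"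
    and y: "two_sided_near_minimal (\<lambda>\<phi>. G \<phi> + y * g \<phi>) h e \<delta>"
    and g: "\<And>\<phi>. g \<phi> = \<alpha> * h \<phi> + \<beta>" and \<alpha>: "0 < \<alpha>" and \<delta>: "0 < \<delta>"
  shows "x = y"
proof -
  have not_less: "\<not> x < y"
    if x: "two_sided_near_minimal (\<lambda>\<phi>. G \<phi> + x * g \<phi>) h e \<delta>"
      and y: "two_sided_near_minimal (\<lambda>\<phi>. G \<phi> + y * g \<phi>) h e \<delta>" for x y
  proof
    assume xy: "x < y"
    then have "0 < (y - x) * (\<alpha> * \<delta>)" using \<alpha> \<delta> by simp
    then obtain k where k: "1 / real (Suc k) < (y - x) * (\<alpha> * \<delta>)"
      using reals_Archimedean by (auto simp: inverse_eq_divide)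
    obtain i where i: "h (e i) < - \<delta>"
        "\<And>j. G (e i) + x * g (e i) \<le> G (e j) + x * g (e j) + 1 / real (Suc k)"
      using x unfolding two_sided_near_minimal_def by meson
    obtain j where j: "h (e j) > \<delta>"
        "\<And>i. G (e j) + y * g (e j) \<le> G (e i) + y * g (e i) + 1 / real (Suc k)"
      using y unfolding two_sided_near_minimal_def by meson
    have "2 * \<delta> \<le> h (e j) - h (e i)" using i(1) j(1) by linarith
    then have "(y - x) * (\<alpha> * (2 * \<delta>)) \<le> (y - x) * (\<alpha> * (h (e j) - h (e i)))"
      using xy \<alpha> by (intro mult_left_mono) auto
    also have "\<dots> = (y - x) * (g (e j) - g (e i))"
      by (simp add: g algebra_simps)
    also have "\<dots> \<le> 2 * (1 / real (Suc k))"
      using i(2)[of j] j(2)[of i] by (simp add: left_diff_distrib right_diff_distrib)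
    finally show False using k by simp
  qed
  show ?thesis using not_less[OF x y] not_less[OF y x] by linarith
qed

text \<open>
  By the decoupling and Fubini's theorem it is enough to freeze the residual disorder \<open>y\<close>. Then at
  most one value of \<open>\<xi>\<close> is exceptional, and the law of \<open>\<xi>\<close> has no atoms.
\<close>

lemma two_sided_near_minimal_null:
  fixes \<eta> :: "int ^ 'd \<Rightarrow> real ^ 'n \<Rightarrow> 'w \<Rightarrow> real" and e :: "nat \<Rightarrow> int ^ 'd \<Rightarrow> real ^ 'n"
  assumes M: "prob_space M" and dis: "fbf_disorder M H \<eta>"
    and fin: "finite \<Lambda>" and v: "v \<in> \<Lambda>" and pq: "p \<noteq> q" and \<delta>: "0 < \<delta>"
  shows "AE \<omega> in M. \<not> two_sided_near_minimal (hamiltonian (\<lambda>w t. \<eta> w t \<omega>) \<Lambda>)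
    (\<lambda>\<phi>. bisector_contrast H p q (\<phi> v)) e \<delta>"
proof -
  interpret prob_space M by fact
  have fbf: "fractional_brownian_field M H (\<eta> w)" for w
    using dis by (simp add: fbf_disorder_def)
  interpret V: centered_gaussian_process M "\<eta> v"
    by (rule fbf_centered_gaussian[OF M fbf])
  have m\<eta> [measurable]: "\<eta> w t \<in> borel_measurable M" for w t
  proof -
    interpret W: centered_gaussian_process M "\<eta> w"
      by (rule fbf_centered_gaussian[OF M fbf])
    show ?thesis by (rule W.measurable_combination[OF linear_combinations_base])
  qed
  define \<xi> where "\<xi> \<omega> = \<eta> v p \<omega> - \<eta> v q \<omega>" for \<omega>
  have \<xi>: "\<xi> \<in> linear_combinations (\<eta> v)"
    unfolding \<xi>_def[abs_def] by (intro linear_combinations_diff linear_combinations_base)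
  have [measurable]: "\<xi> \<in> borel_measurable M" by (rule V.measurable_combination[OF \<xi>])
  define s where "s = norm (p - q) powr (2 * H)"
  have s: "s > 0" using pq by (simp add: s_def)
  have var: "expectation (\<lambda>\<omega>. (\<xi> \<omega>)\<^sup>2) = s"
    unfolding \<xi>_def s_def by (rule fbf_increment_second_moment[OF M fbf])
  obtain \<kappa> where \<kappa>: "\<And>t. expectation (\<lambda>\<omega>. \<xi> \<omega> * \<eta> v t \<omega>) = (bisector_contrast H p q t + \<kappa>) / 2"
    unfolding \<xi>_def using fbf_covariance_increment[OF M fbf, of v p q] by blast
  define g where "g t = (bisector_contrast H p q t + \<kappa>) / (2 * s)" for t
  have g: "expectation (\<lambda>\<omega>. \<xi> \<omega> * \<eta> v t \<omega>) = g t * expectation (\<lambda>\<omega>. \<xi> \<omega> * \<xi> \<omega>)" for t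
    using var s by (simp add: \<kappa> g_def power2_eq_square)
  have g_affine: "g t = 1 / (2 * s) * bisector_contrast H p q t + \<kappa> / (2 * s)" for t
    by (simp add: g_def add_divide_distrib)
  define Y where "Y = (\<lambda>(w, t) \<omega>. \<eta> w t \<omega> - (if w = v then g t * \<xi> \<omega> else 0))"
  let ?P = "Pi\<^sub>M UNIV (\<lambda>_. borel) :: ((int ^ 'd) \<times> (real ^ 'n) \<Rightarrow> real) measure"
  let ?N1 = "distr M borel \<xi>" and ?N2 = "distr M ?P (\<lambda>\<omega> i. Y i \<omega>)"
  have prod: "?N1 \<Otimes>\<^sub>M ?N2 = distr M (borel \<Otimes>\<^sub>M ?P) (\<lambda>\<omega>. (\<xi> \<omega>, \<lambda>i. Y i \<omega>))"
    using fbf_disorder_decoupling[OF dis, of v p q g] g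
    unfolding \<xi>_def[abs_def] Y_def by simp
  have mY: "Y i \<in> borel_measurable M" for i
    unfolding Y_def by (cases i; cases "fst i = v") auto
  have mYY: "(\<lambda>\<omega> i. Y i \<omega>) \<in> measurable M ?P"
    by (rule measurable_PiM_single') (auto simp: space_PiM mY)
  interpret N1: prob_space ?N1 by (rule prob_space_distr) measurable
  interpret N2: prob_space ?N2 by (rule prob_space_distr[OF mYY])
  interpret N12: pair_sigma_finite ?N1 ?N2 ..
  define G where "G y \<phi> = 1 / 2 * (\<Sum>e\<in>edges_meeting \<Lambda>. edge_energy \<phi> e) + (\<Sum>w\<in>\<Lambda>. y (w, \<phi> w))"
    for y and \<phi> :: "int ^ 'd \<Rightarrow> real ^ 'n"
  have ham: "hamiltonian (\<lambda>w t. \<eta> w t \<omega>) \<Lambda> \<phi> = G (\<lambda>i. Y i \<omega>) \<phi> + \<xi> \<omega> * g (\<phi> v)" for \<omega> \<phi>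
  proof -
    have "(\<Sum>w\<in>\<Lambda>. Y (w, \<phi> w) \<omega>) = (\<Sum>w\<in>\<Lambda>. \<eta> w (\<phi> w) \<omega>) - (\<Sum>w\<in>\<Lambda>. if w = v then g (\<phi> w) * \<xi> \<omega> else 0)"
      by (simp add: Y_def sum_subtractf)
    also have "(\<Sum>w\<in>\<Lambda>. if w = v then g (\<phi> w) * \<xi> \<omega> else 0) = g (\<phi> v) * \<xi> \<omega>"
      using fin v by (simp add: sum.delta)
    finally show ?thesis by (simp add: hamiltonian_def G_def)
  qed
  define T where "T x y \<longleftrightarrow> two_sided_near_minimal (\<lambda>\<phi>. G y \<phi> + x * g (\<phi> v))
    (\<lambda>\<phi>. bisector_contrast H p q (\<phi> v)) e \<delta>" for x y
  have T_unique: "x = x'" if "T x y" "T x' y" for x x' y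
    using that unfolding T_def
    by (rule two_sided_near_minimal_tilt_unique[where \<alpha> = "1 / (2 * s)" and \<beta> = "\<kappa> / (2 * s)"])
      (use s \<delta> g_affine in auto)
  have [measurable]: "(\<lambda>z. G (snd z) \<phi>) \<in> borel_measurable (borel \<Otimes>\<^sub>M ?P)" for \<phi>
    unfolding G_def
    by (intro borel_measurable_add borel_measurable_const borel_measurable_sum
        measurable_compose[OF measurable_snd measurable_component_singleton]) auto
  have mT: "Measurable.pred (borel \<Otimes>\<^sub>M ?P) (\<lambda>z. \<not> T (fst z) (snd z))"
    unfolding T_def two_sided_near_minimal_def by measurable
  have "AE x in ?N1. \<not> T x y" for y
  proof (cases "\<exists>c. T c y")
    case True
    then obtain c where c: "T c y" ..
    have "AE x in ?N1. x \<noteq> c"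
      using V.gaussian_combination[OF \<xi>] V.centered_combination[OF \<xi>]
      by (rule centered_gaussian_no_atoms) (use var s in simp)
    then show ?thesis using T_unique[OF c] by (auto elim: AE_mp)
  qed simp
  then have "AE y in ?N2. AE x in ?N1. \<not> T x y" by simp
  \<comment> \<open>The product measure integrates \<open>\<xi>\<close> first; the null set is found by fixing the residual first.\<close>
  then have "AE x in ?N1. AE y in ?N2. \<not> T x y"
    by (subst N12.AE_commute) (use mT in \<open>simp_all add: pred_def space_pair_measure\<close>)
  then have "AE z in ?N1 \<Otimes>\<^sub>M ?N2. \<not> T (fst z) (snd z)"
    by (intro N12.AE_pair_measure) (use mT in \<open>simp_all add: pred_def space_pair_measure\<close>)
  then have "AE \<omega> in M. \<not> T (\<xi> \<omega>) (\<lambda>i. Y i \<omega>)"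
    unfolding prod
    by (subst (asm) AE_distr_iff) (use mT mYY in \<open>simp_all add: pred_def\<close>)
  then show ?thesis
    unfolding T_def ham[abs_def] .
qed

text \<open>
  Configurations with values in \<open>Q\<close> on the finite set \<open>\<Lambda>\<close>, equal to \<open>\<tau>\<close> elsewhere.
\<close>

lemma countable_dense_configurations:
  fixes \<tau> :: "int ^ 'd \<Rightarrow> real ^ 'n"
  assumes fin: "finite \<Lambda>" and Q: "countable (Q :: (real ^ 'n) set)"
    and dense: "\<And>X :: (real ^ 'n) set. open X \<Longrightarrow> X \<noteq> {} \<Longrightarrow> \<exists>q\<in>Q. q \<in> X"
  shows "\<exists>e :: nat \<Rightarrow> int ^ 'd \<Rightarrow> real ^ 'n. range e \<subseteq> configurations \<Lambda> \<tau> \<and>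
    (\<forall>S \<phi>. open S \<longrightarrow> \<phi> \<in> S \<longrightarrow> \<phi> \<in> configurations \<Lambda> \<tau> \<longrightarrow> (\<exists>i. e i \<in> S))"
proof -
  define ext where "ext f w = (if w \<in> \<Lambda> then f w else \<tau> w)" for f and w :: "int ^ 'd"
  define D where "D = ext ` (\<Pi>\<^sub>E w\<in>\<Lambda>. Q)"
  have D: "countable D" unfolding D_def using fin Q by (intro countable_image countable_PiE) auto
  have D_conf: "D \<subseteq> configurations \<Lambda> \<tau>" by (auto simp: D_def ext_def configurations_def)
  have hit: "\<exists>\<psi>\<in>D. \<psi> \<in> S" if S: "open S" "\<phi> \<in> S" and \<phi>: "\<phi> \<in> configurations \<Lambda> \<tau>" for S \<phi>
  proof -
    have "openin (product_topology (\<lambda>_. euclidean) UNIV) S"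
      using S(1) by (simp only: open_fun_def)
    from product_topology_open_contains_basis[OF this S(2)]
    obtain X where X: "\<phi> \<in> (\<Pi>\<^sub>E w\<in>UNIV. X w)" "\<And>w. openin euclidean (X w)"
        "(\<Pi>\<^sub>E w\<in>UNIV. X w) \<subseteq> S"
      by (elim exE conjE) simp
    have \<phi>_X: "\<phi> w \<in> X w" for w using X(1) by (simp add: PiE_iff)
    have "\<exists>a\<in>Q. a \<in> X w" for w
      using X(2)[of w] \<phi>_X[of w] by (intro dense) auto
    then obtain a where a: "\<And>w. a w \<in> Q" "\<And>w. a w \<in> X w"
      by metis
    have "ext (restrict a \<Lambda>) \<in> D"
      unfolding D_def by (intro imageI) (auto simp: a)
    moreover have "ext (restrict a \<Lambda>) w \<in> X w" for w
      using \<phi>_X[of w] \<phi> a(2)[of w]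
      by (cases "w \<in> \<Lambda>") (simp_all add: ext_def configurations_def)
    then have "ext (restrict a \<Lambda>) \<in> (\<Pi>\<^sub>E w\<in>UNIV. X w)" by (simp add: PiE_iff)
    then have "ext (restrict a \<Lambda>) \<in> S" using X(3) by (rule rev_subsetD)
    ultimately show ?thesis by blast
  qed
  have "D \<noteq> {}" using hit[of UNIV \<tau>] by (auto simp: configurations_def)
  then have "range (from_nat_into D) = D" using D by (rule range_from_nat_into)
  then have range: "range (from_nat_into D) = D" .
  have "\<exists>i. from_nat_into D i \<in> S"
    if S: "open S" "\<phi> \<in> S" and \<phi>: "\<phi> \<in> configurations \<Lambda> \<tau>" for S \<phi>
  proof -
    obtain \<psi> where \<psi>: "\<psi> \<in> D" "\<psi> \<in> S" using hit[OF S \<phi>] by blast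
    obtain i where "\<psi> = from_nat_into D i" using \<psi>(1) range by (metis imageE)
    then show ?thesis using \<psi>(2) by (intro exI[of _ i]) simp
  qed
  then show ?thesis
    using D_conf range by (intro exI[of _ "from_nat_into D"]) simp
qed

text \<open>
  By continuity, the configurations that are almost as good as a minimiser and lie on its side of
  the bisector form an open set, so the dense sequence meets it.
\<close>

lemma two_minimisers_imp_two_sided:
  fixes \<eta> :: "int ^ 'd \<Rightarrow> real ^ 'n \<Rightarrow> real"
  assumes H: "0 < H"
    and cont: "\<And>v. v \<in> \<Lambda> \<Longrightarrow> continuous_on UNIV (\<eta> v)"
    and e: "range e \<subseteq> configurations \<Lambda> \<tau>"
    and dense: "\<And>S \<phi>. open S \<Longrightarrow> \<phi> \<in> S \<Longrightarrow> \<phi> \<in> configurations \<Lambda> \<tau> \<Longrightarrow> \<exists>i. e i \<in> S"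
    and \<phi>: "is_arg_min (hamiltonian \<eta> \<Lambda>) (\<lambda>\<psi>. \<psi> \<in> configurations \<Lambda> \<tau>) \<phi>"
    and \<psi>: "is_arg_min (hamiltonian \<eta> \<Lambda>) (\<lambda>\<psi>. \<psi> \<in> configurations \<Lambda> \<tau>) \<psi>"
    and \<phi>_side: "\<delta> < bisector_contrast H p q (\<phi> v)"
    and \<psi>_side: "bisector_contrast H p q (\<psi> v) < - \<delta>"
  shows "two_sided_near_minimal (hamiltonian \<eta> \<Lambda>) (\<lambda>\<phi>. bisector_contrast H p q (\<phi> v)) e \<delta>"
proof -
  let ?h = "\<lambda>\<phi> :: int ^ 'd \<Rightarrow> real ^ 'n. bisector_contrast H p q (\<phi> v)"
  have ham: "continuous_on UNIV (hamiltonian \<eta> \<Lambda>)"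
    by (rule continuous_hamiltonian) (rule cont)
  have h: "continuous_on UNIV ?h"
    by (rule continuous_on_compose2[OF continuous_bisector_contrast[OF H, of p q]
          continuous_on_product_coordinates[of v]]) (rule subset_UNIV)
  have near: "\<exists>i. e i \<in> S \<and> (\<forall>j. hamiltonian \<eta> \<Lambda> (e i) \<le> hamiltonian \<eta> \<Lambda> (e j) + 1 / real (Suc k))"
    if \<theta>: "is_arg_min (hamiltonian \<eta> \<Lambda>) (\<lambda>\<psi>. \<psi> \<in> configurations \<Lambda> \<tau>) \<theta>"
      and S: "open S" "\<theta> \<in> S" for \<theta> S k
  proof -
    let ?S = "S \<inter> {\<psi>. hamiltonian \<eta> \<Lambda> \<psi> < hamiltonian \<eta> \<Lambda> \<theta> + 1 / real (Suc k)}"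
    have "open {\<psi>. hamiltonian \<eta> \<Lambda> \<psi> < hamiltonian \<eta> \<Lambda> \<theta> + 1 / real (Suc k)}"
      by (rule open_Collect_less[OF ham continuous_on_const])
    with S(1) have "open ?S" by (rule open_Int)
    moreover have "\<theta> \<in> ?S" using S by simp
    moreover have \<theta>_conf: "\<theta> \<in> configurations \<Lambda> \<tau>"
      using \<theta> unfolding is_arg_min_def by (rule conjunct1)
    ultimately have "\<exists>i. e i \<in> ?S" by (rule dense)
    then obtain i where i: "e i \<in> S" "hamiltonian \<eta> \<Lambda> (e i) < hamiltonian \<eta> \<Lambda> \<theta> + 1 / real (Suc k)"
      by auto
    have "hamiltonian \<eta> \<Lambda> (e i) \<le> hamiltonian \<eta> \<Lambda> (e j) + 1 / real (Suc k)" for j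
    proof -
      have "e j \<in> configurations \<Lambda> \<tau>" using e by blast
      then have "hamiltonian \<eta> \<Lambda> \<theta> \<le> hamiltonian \<eta> \<Lambda> (e j)"
        using \<theta> unfolding is_arg_min_linorder by blast
      then show ?thesis using i(2) by linarith
    qed
    then show ?thesis using i(1) by blast
  qed
  show ?thesis
    unfolding two_sided_near_minimal_def
  proof (intro allI conjI)
    fix k
    have "open {\<phi>. \<delta> < ?h \<phi>}" "open {\<phi>. ?h \<phi> < - \<delta>}"
      by (rule open_Collect_less[OF continuous_on_const h], rule open_Collect_less[OF h continuous_on_const])
    then show "\<exists>i. \<delta> < ?h (e i) \<and> (\<forall>j. hamiltonian \<eta> \<Lambda> (e i) \<le> hamiltonian \<eta> \<Lambda> (e j) + 1 / real (Suc k))"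
      and "\<exists>i. ?h (e i) < - \<delta> \<and> (\<forall>j. hamiltonian \<eta> \<Lambda> (e i) \<le> hamiltonian \<eta> \<Lambda> (e j) + 1 / real (Suc k))"
      using near[OF \<phi>, of "{\<phi>. \<delta> < ?h \<phi>}" k] near[OF \<psi>, of "{\<phi>. ?h \<phi> < - \<delta>}" k]
        \<phi>_side \<psi>_side by simp_all
  qed
qed

theorem proposition1p1:
  fixes M :: "'w measure"
    and H :: real
    and \<eta> :: "int ^ 'd \<Rightarrow> real ^ 'n \<Rightarrow> 'w \<Rightarrow> real"
    and \<Lambda> :: "(int ^ 'd) set"
    and \<tau> :: "int ^ 'd \<Rightarrow> real ^ 'n"
  assumes "prob_space M"
    and "0 < H" "H < 1"
    and "fbf_disorder M H \<eta>"
    and "finite \<Lambda>"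
  shows "AE \<omega> in M. \<exists>!\<phi>. is_arg_min (hamiltonian (\<lambda>v t. \<eta> v t \<omega>) \<Lambda>)
                            (\<lambda>\<psi>. \<psi> \<in> configurations \<Lambda> \<tau>) \<phi>"
proof -
  have fbf: "fractional_brownian_field M H (\<eta> v)" for v
    using assms(4) by (simp add: fbf_disorder_def)
  obtain Q :: "(real ^ 'n) set" where Q: "countable Q"
    and dense: "\<And>X. open X \<Longrightarrow> X \<noteq> {} \<Longrightarrow> \<exists>q\<in>Q. q \<in> X"
    using countable_dense_exists by metis
  obtain e :: "nat \<Rightarrow> int ^ 'd \<Rightarrow> real ^ 'n" where e: "range e \<subseteq> configurations \<Lambda> \<tau>"
    and e_dense: "\<And>S \<phi>. open S \<Longrightarrow> \<phi> \<in> S \<Longrightarrow> \<phi> \<in> configurations \<Lambda> \<tau> \<Longrightarrow> \<exists>i. e i \<in> S"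
    using countable_dense_configurations[OF assms(5) Q dense, of \<tau>] by metis
  have "AE \<omega> in M. \<forall>v\<in>\<Lambda>. continuous_on UNIV (\<lambda>t. \<eta> v t \<omega>)"
    using assms(5) fbf by (intro AE_finite_allI) (auto simp: fractional_brownian_field_def)
  moreover have "AE \<omega> in M. \<forall>v\<in>\<Lambda>. \<exists>A\<ge>0. \<forall>t. \<bar>\<eta> v t \<omega>\<bar> \<le> A * (1 + norm t)"
    using assms(5) by (intro AE_finite_allI fbf_linear_growth[OF assms(1-3) fbf])
  moreover have "AE \<omega> in M. \<forall>(v, p, q)\<in>{(v, p, q). v \<in> \<Lambda> \<and> p \<in> Q \<and> q \<in> Q \<and> p \<noteq> q}. \<forall>k.
      \<not> two_sided_near_minimal (hamiltonian (\<lambda>v t. \<eta> v t \<omega>) \<Lambda>)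
        (\<lambda>\<phi>. bisector_contrast H p q (\<phi> v)) e (1 / real (Suc k))"
  proof -
    have "countable {(v, p, q). v \<in> \<Lambda> \<and> p \<in> Q \<and> q \<in> Q \<and> p \<noteq> q}"
      by (rule countable_subset[of _ "\<Lambda> \<times> Q \<times> Q"]) (auto intro: Q countable_finite assms(5))
    then show ?thesis
      by (subst AE_ball_countable)
        (auto simp: AE_all_countable intro!: two_sided_near_minimal_null[OF assms(1,4,5)])
  qed
  ultimately show ?thesis
  proof eventually_elim
    case (elim \<omega>)
    let ?min = "is_arg_min (hamiltonian (\<lambda>v t. \<eta> v t \<omega>) \<Lambda>) (\<lambda>\<psi>. \<psi> \<in> configurations \<Lambda> \<tau>)"
    have "\<exists>\<phi>. ?min \<phi>"
      using elim by (intro hamiltonian_minimiser_exists assms(5)) auto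
    moreover have "\<phi> = \<psi>" if \<phi>: "?min \<phi>" and \<psi>: "?min \<psi>" for \<phi> \<psi>
    proof (rule ccontr)
      assume "\<phi> \<noteq> \<psi>"
      then obtain v where v: "\<phi> v \<noteq> \<psi> v" by auto
      have "\<phi> \<in> configurations \<Lambda> \<tau>" "\<psi> \<in> configurations \<Lambda> \<tau>"
        using \<phi> \<psi> unfolding is_arg_min_def by (blast dest: conjunct1)+
      then have "v \<in> \<Lambda>"
        using v unfolding configurations_def mem_Collect_eq by metis
      obtain p q where pq: "p \<in> Q" "q \<in> Q" "p \<noteq> q"
        and sides: "bisector_contrast H p q (\<phi> v) > 0" "bisector_contrast H p q (\<psi> v) < 0"
        by (rule bisector_contrast_separates[OF assms(2) v dense])
      define \<epsilon> where "\<epsilon> = min (bisector_contrast H p q (\<phi> v)) (- bisector_contrast H p q (\<psi> v))"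
      have "0 < \<epsilon>" using sides by (simp add: \<epsilon>_def)
      then obtain k where "inverse (real (Suc k)) < \<epsilon>"
        using reals_Archimedean by blast
      then have k: "1 / real (Suc k) < bisector_contrast H p q (\<phi> v)"
        "bisector_contrast H p q (\<psi> v) < - (1 / real (Suc k))"
        by (simp_all only: \<epsilon>_def inverse_eq_divide min_less_iff_conj) linarith+
      have cont: "\<And>w. w \<in> \<Lambda> \<Longrightarrow> continuous_on UNIV (\<lambda>t. \<eta> w t \<omega>)"
        using elim(1) by blast
      have "two_sided_near_minimal (hamiltonian (\<lambda>v t. \<eta> v t \<omega>) \<Lambda>)
          (\<lambda>\<phi>. bisector_contrast H p q (\<phi> v)) e (1 / real (Suc k))"
        by (rule two_minimisers_imp_two_sided[OF assms(2) cont e e_dense \<phi> \<psi> k])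
      then show False
        using elim(3) pq \<open>v \<in> \<Lambda>\<close> by blast
    qed
    ultimately show ?case by (rule ex_ex1I)
  qed
qed

end
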